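(* Let $\kappa$ be a field and $D_\infty=\langle a,b\mid b^2=1,\ ba=a^{-1}b\rangle$ the infinite dihedral group. There is a surjection, given by $(\nu,\omega)\mapsto\sigma_\nu\sigma_\omega$ (pointwise product), from the semigroup of all pairs of functions $(\nu,\omega)$, where $\nu:\mathbb{Z}^+\sqcup\mathbb{Z}\to\{0,1\}$ and $\omega:\mathbb{Z}^+\times\mathbb{Z}^+\sqcup\mathbb{Z}^+\times\mathbb{Z}\to\{0,1\}$, onto the semigroup of all idempotent factor sets of $D_\infty$.
   Context: A partial projective $\sigma$-representation of a group $G$ in a unital (associative) $\kappa$-algebra $R$ (with $1_R\neq 0$) is a map $\Gamma:G\to R$ for which there is a function $\sigma:G\times G\to\kappa$ (called the factor set) such that for all $g,h\in G$: (i) if $\sigma(g,h)=0$ then $\Gamma(g^{-1})\Gamma(gh)=0$ and $\Gamma(gh)\Gamma(h^{-1})=0$; (ii) if $\Gamma(g)\Gamma(h)=0$ then $\sigma(g,h)=0$; (iii) $\Gamma(1_G)=1_R$; (iv) $\Gamma(g^{-1})\Gamma(g)\Gamma(h)=\sigma(g,h)\Gamma(g^{-1})\Gamma(gh)$; (v) $\Gamma(g)\Gamma(h)\Gamma(h^{-1})=\sigma(g,h)\Gamma(gh)\Gamma(h^{-1})$. The set of all factor sets of $G$ (over all such $R$ and $\Gamma$) is $pm(G)$, a semigroup under pointwise multiplication. A factor set is idempotent if all its values lie in $\{0,1\}$. $\mathbb{Z}^+$ is the set of positive integers; sets of functions are semigroups under pointwise multiplication, and pairs are multiplied componentwise. For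 $\nu=(\nu_0,\nu_1)$ with $\nu_0:\mathbb{Z}^+\to\{0,1\}$, $\nu_1:\mathbb{Z}\to\{0,1\}$, put $S_\nu=\{a^i,a^{-i}:i\in\mathbb{Z}^+,\nu_0(i)=0\}\cup\{ba^i:i\in\mathbb{Z},\nu_1(i)=0\}$ and let $\sigma_\nu(x,y)=0$ if $\{x,y,xy\}\cap S_\nu\neq\varnothing$, $\sigma_\nu(x,y)=1$ otherwise. For $x,y\in D_\infty$ let $C_{(x,y)}:=\{(x,y),(y^{-1}x^{-1},x),(y,y^{-1}x^{-1}),(y^{-1},x^{-1}),(x^{-1},xy),(xy,y^{-1})\}$. For $\omega=(\omega_0,\omega_1)$ with $\omega_0:\mathbb{Z}^+\times\mathbb{Z}^+\to\{0,1\}$, $\omega_1:\mathbb{Z}^+\times\mathbb{Z}\to\{0,1\}$, put $W_\omega=\{(a^n,a^m):(n,m)\in\mathbb{Z}^+\times\mathbb{Z}^+,\omega_0(n,m)=0\}\cup\{(a^i,ba^j):(i,j)\in\mathbb{Z}^+\times\mathbb{Z},\omega_1(i,j)=0\}$ and let $\sigma_\omega(x,y)=0$ if $C_{(x,y)}\cap W_\omega\neq\varnothing$, $\sigma_\omega(x,y)=1$ otherwise. *)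

theory Defs
  imports "HOL-Algebra.Algebra"
begin

section \<open>Unital associative algebras\<close>

text \<open>The library locale \<open>algebra\<close> only covers commutative algebras.\<close>

locale assoc_algebra = module + ring M +
  assumes smult_mult_left:
      "\<lbrakk> c \<in> carrier R; x \<in> carrier M; y \<in> carrier M \<rbrakk> \<Longrightarrow>
        (c \<odot>\<^bsub>M\<^esub> x) \<otimes>\<^bsub>M\<^esub> y = c \<odot>\<^bsub>M\<^esub> (x \<otimes>\<^bsub>M\<^esub> y)"
    and smult_mult_right:
      "\<lbrakk> c \<in> carrier R; x \<in> carrier M; y \<in> carrier M \<rbrakk> \<Longrightarrow>
        x \<otimes>\<^bsub>M\<^esub> (c \<odot>\<^bsub>M\<^esub> y) = c \<odot>\<^bsub>M\<^esub> (x \<otimes>\<^bsub>M\<^esub> y)"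


section \<open>Partial projective representations and factor sets\<close>

definition partial_projective_rep ::
  "('k, 'm) ring_scheme \<Rightarrow> ('g, 'n) monoid_scheme \<Rightarrow> ('k, 'r, 'l) module_scheme \<Rightarrow>
   ('g \<Rightarrow> 'r) \<Rightarrow> ('g \<times> 'g \<Rightarrow> 'k) \<Rightarrow> bool" where
  "partial_projective_rep K G R \<Gamma> \<sigma> \<longleftrightarrow>
     \<Gamma> \<in> carrier G \<rightarrow> carrier R \<and>
     \<sigma> \<in> carrier G \<times> carrier G \<rightarrow>\<^sub>E carrier K \<and>
     \<Gamma> \<one>\<^bsub>G\<^esub> = \<one>\<^bsub>R\<^esub> \<and>
     (\<forall>g \<in> carrier G. \<forall>h \<in> carrier G.
        (\<sigma> (g, h) = \<zero>\<^bsub>K\<^esub> \<longrightarrow>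
           \<Gamma> (inv\<^bsub>G\<^esub> g) \<otimes>\<^bsub>R\<^esub> \<Gamma> (g \<otimes>\<^bsub>G\<^esub> h) = \<zero>\<^bsub>R\<^esub> \<and>
           \<Gamma> (g \<otimes>\<^bsub>G\<^esub> h) \<otimes>\<^bsub>R\<^esub> \<Gamma> (inv\<^bsub>G\<^esub> h) = \<zero>\<^bsub>R\<^esub>) \<and>
        (\<Gamma> g \<otimes>\<^bsub>R\<^esub> \<Gamma> h = \<zero>\<^bsub>R\<^esub> \<longrightarrow> \<sigma> (g, h) = \<zero>\<^bsub>K\<^esub>) \<and>
        \<Gamma> (inv\<^bsub>G\<^esub> g) \<otimes>\<^bsub>R\<^esub> \<Gamma> g \<otimes>\<^bsub>R\<^esub> \<Gamma> h
          = \<sigma> (g, h) \<odot>\<^bsub>R\<^esub> (\<Gamma> (inv\<^bsub>G\<^esub> g) \<otimes>\<^bsub>R\<^esub> \<Gamma> (g \<otimes>\<^bsub>G\<^esub> h)) \<and>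
        \<Gamma> g \<otimes>\<^bsub>R\<^esub> \<Gamma> h \<otimes>\<^bsub>R\<^esub> \<Gamma> (inv\<^bsub>G\<^esub> h)
          = \<sigma> (g, h) \<odot>\<^bsub>R\<^esub> (\<Gamma> (g \<otimes>\<^bsub>G\<^esub> h) \<otimes>\<^bsub>R\<^esub> \<Gamma> (inv\<^bsub>G\<^esub> h)))"

text \<open>
  HOL cannot quantify over the type of the elements of \<open>R\<close> inside a formula, so the definition
  of \<open>pm\<close> fixes one type, that of formal sums of scalar multiples of words in \<open>G\<close>. Since the
  subalgebra generated by the range of \<open>\<Gamma>\<close> embeds into this type, an algebra over any other
  type gives no further factor sets; this is lemma \<open>factor_set_in_pm\<close> below.
\<close>

definition pm ::
  "('k, 'm) ring_scheme \<Rightarrow> ('g, 'n) monoid_scheme \<Rightarrow> ('g \<times> 'g \<Rightarrow> 'k) set" where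
  "pm K G = {\<sigma>. \<exists>(R :: ('k, ('k \<times> 'g list) list) module) \<Gamma>.
     assoc_algebra K R \<and> \<one>\<^bsub>R\<^esub> \<noteq> \<zero>\<^bsub>R\<^esub> \<and> partial_projective_rep K G R \<Gamma> \<sigma>}"

definition idempotent_factor_sets ::
  "('k, 'm) ring_scheme \<Rightarrow> ('g, 'n) monoid_scheme \<Rightarrow> ('g \<times> 'g \<Rightarrow> 'k) set" where
  "idempotent_factor_sets K G =
     {\<sigma> \<in> pm K G. \<forall>g \<in> carrier G. \<forall>h \<in> carrier G. \<sigma> (g, h) \<in> {\<zero>\<^bsub>K\<^esub>, \<one>\<^bsub>K\<^esub>}}"

definition idempotent_factor_semigroup ::
  "('k, 'm) ring_scheme \<Rightarrow> ('g, 'n) monoid_scheme \<Rightarrow> ('g \<times> 'g \<Rightarrow> 'k) monoid" where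
  "idempotent_factor_semigroup K G =
     (product_group (carrier G \<times> carrier G) (\<lambda>_. K))
       \<lparr>carrier := idempotent_factor_sets K G\<rparr>"


subsection \<open>Independence of the choice of type\<close>

definition word_eval :: "('k, 'r, 'l) module_scheme \<Rightarrow> ('g \<Rightarrow> 'r) \<Rightarrow> 'g list \<Rightarrow> 'r" where
  "word_eval R \<Gamma> w = foldr (\<lambda>g r. \<Gamma> g \<otimes>\<^bsub>R\<^esub> r) w \<one>\<^bsub>R\<^esub>"

definition sum_eval ::
  "('k, 'r, 'l) module_scheme \<Rightarrow> ('g \<Rightarrow> 'r) \<Rightarrow> ('k \<times> 'g list) list \<Rightarrow> 'r" where
  "sum_eval R \<Gamma> t = foldr (\<lambda>(c, w) r. (c \<odot>\<^bsub>R\<^esub> word_eval R \<Gamma> w) \<oplus>\<^bsub>R\<^esub> r) t \<zero>\<^bsub>R\<^esub>"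

lemma word_eval_simps [simp]:
  "word_eval R \<Gamma> [] = \<one>\<^bsub>R\<^esub>" "word_eval R \<Gamma> (g # w) = \<Gamma> g \<otimes>\<^bsub>R\<^esub> word_eval R \<Gamma> w"
  by (simp_all add: word_eval_def)

lemma sum_eval_simps [simp]:
  "sum_eval R \<Gamma> [] = \<zero>\<^bsub>R\<^esub>"
  "sum_eval R \<Gamma> (p # t) = (fst p \<odot>\<^bsub>R\<^esub> word_eval R \<Gamma> (snd p)) \<oplus>\<^bsub>R\<^esub> sum_eval R \<Gamma> t"
  by (simp_all add: sum_eval_def case_prod_unfold)

text \<open>An algebra may be transported along an injection of a subalgebra.\<close>

lemma assoc_algebra_transport:
  fixes K (structure) and R :: "('k, 'r, 'l) module_scheme"
    and \<phi> :: "'r \<Rightarrow> 's" and \<psi> :: "'s \<Rightarrow> 'r"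
  assumes alg: "assoc_algebra K R" and sub: "A \<subseteq> carrier R"
    and one: "\<one>\<^bsub>R\<^esub> \<in> A"
    and add: "\<And>x y. x \<in> A \<Longrightarrow> y \<in> A \<Longrightarrow> x \<oplus>\<^bsub>R\<^esub> y \<in> A"
    and mul: "\<And>x y. x \<in> A \<Longrightarrow> y \<in> A \<Longrightarrow> x \<otimes>\<^bsub>R\<^esub> y \<in> A"
    and sm: "\<And>c x. c \<in> carrier K \<Longrightarrow> x \<in> A \<Longrightarrow> c \<odot>\<^bsub>R\<^esub> x \<in> A"
    and inverse: "\<And>x. x \<in> A \<Longrightarrow> \<psi> (\<phi> x) = x"
  defines "T \<equiv> \<lparr>carrier = \<phi> ` A, monoid.mult = (\<lambda>s t. \<phi> (\<psi> s \<otimes>\<^bsub>R\<^esub> \<psi> t)),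
     one = \<phi> \<one>\<^bsub>R\<^esub>, ring.zero = \<phi> \<zero>\<^bsub>R\<^esub>, ring.add = (\<lambda>s t. \<phi> (\<psi> s \<oplus>\<^bsub>R\<^esub> \<psi> t)),
     module.smult = (\<lambda>c t. \<phi> (c \<odot>\<^bsub>R\<^esub> \<psi> t))\<rparr>"
  shows "assoc_algebra K T" "\<zero>\<^bsub>R\<^esub> \<in> A"
proof -
  interpret assoc_algebra K R by fact
  have in_R [simp]: "x \<in> carrier R" if "x \<in> A" for x using sub that by blast
  have "\<zero>\<^bsub>K\<^esub> \<odot>\<^bsub>R\<^esub> \<one>\<^bsub>R\<^esub> = \<zero>\<^bsub>R\<^esub>" using one in_R smult_l_null by blast
  then show zero: "\<zero>\<^bsub>R\<^esub> \<in> A" using sm[OF _ one] by (metis R.zero_closed)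
  note [simp] = one add mul sm inverse zero
  have neg: "\<exists>y \<in> A. y \<oplus>\<^bsub>R\<^esub> x = \<zero>\<^bsub>R\<^esub>" if "x \<in> A" for x
  proof
    show "(\<ominus>\<^bsub>K\<^esub> \<one>\<^bsub>K\<^esub>) \<odot>\<^bsub>R\<^esub> x \<in> A" using that by simp
    show "(\<ominus>\<^bsub>K\<^esub> \<one>\<^bsub>K\<^esub>) \<odot>\<^bsub>R\<^esub> x \<oplus>\<^bsub>R\<^esub> x = \<zero>\<^bsub>R\<^esub>"
      using that by (simp add: smult_l_minus M.l_neg)
  qed
  have ag: "abelian_group T"
  proof (rule abelian_groupI)
    fix x assume "x \<in> carrier T"
    then obtain u where u: "u \<in> A" "x = \<phi> u" by (auto simp: T_def)
    with neg obtain v where "v \<in> A" "v \<oplus>\<^bsub>R\<^esub> u = \<zero>\<^bsub>R\<^esub>" by blast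
    with u show "\<exists>y\<in>carrier T. y \<oplus>\<^bsub>T\<^esub> x = \<zero>\<^bsub>T\<^esub>"
      by (intro bexI[of _ "\<phi> v"]) (simp_all add: T_def)
  qed (auto simp: T_def M.a_ac)
  have ring: "ring T"
  proof (rule ringI[OF ag])
    show "Group.monoid T"
      by (rule monoidI) (auto simp: T_def m_assoc)
  qed (auto simp: T_def l_distr r_distr)
  have mod: "module K T"
    by (rule moduleI[OF R.is_cring ag])
       (auto simp: T_def smult_l_distr smult_r_distr smult_assoc1)
  show "assoc_algebra K T"
    by (intro assoc_algebra.intro mod ring assoc_algebra_axioms.intro)
       (auto simp: T_def smult_mult_left smult_mult_right)
qed

lemma factor_set_in_pm:
  fixes K (structure) and G :: "('g, 'n) monoid_scheme" and R :: "('k, 'r, 'l) module_scheme"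
  assumes G: "group G" and alg: "assoc_algebra K R" and nz: "\<one>\<^bsub>R\<^esub> \<noteq> \<zero>\<^bsub>R\<^esub>"
    and rep: "partial_projective_rep K G R \<Gamma> \<sigma>"
  shows "\<sigma> \<in> pm K G"
proof -
  interpret assoc_algebra K R by fact
  interpret G: group G by fact
  have \<Gamma>: "\<Gamma> g \<in> carrier R" if "g \<in> carrier G" for g
    using rep that by (auto simp: partial_projective_rep_def)
  define V where "V = lists (carrier K \<times> lists (carrier G))"
  define E where "E = sum_eval R \<Gamma>"
  define A where "A = E ` V"
  define \<phi> where "\<phi> x = (SOME t. t \<in> V \<and> E t = x)" for x
  have word_closed [simp]: "word_eval R \<Gamma> w \<in> carrier R" if "w \<in> lists (carrier G)" for w
    using that by (induction w) (auto simp: \<Gamma>)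
  have word_closed' [simp]: "word_eval R \<Gamma> w \<in> carrier R" if "\<forall>x\<in>set w. x \<in> carrier G" for w
    using that word_closed by (simp add: in_listsI)
  have E_closed [simp]: "E t \<in> carrier R" if "t \<in> V" for t
    using that unfolding V_def E_def by (induction t) auto
  have word_append: "word_eval R \<Gamma> (v @ w) = word_eval R \<Gamma> v \<otimes>\<^bsub>R\<^esub> word_eval R \<Gamma> w"
    if "v \<in> lists (carrier G)" "w \<in> lists (carrier G)" for v w
    using that by (induction v) (auto simp: \<Gamma> m_assoc)
  have E_Nil [simp]: "E [] = \<zero>\<^bsub>R\<^esub>" by (simp add: E_def)
  have E_Cons [simp]: "E (p # t) = (fst p \<odot>\<^bsub>R\<^esub> word_eval R \<Gamma> (snd p)) \<oplus>\<^bsub>R\<^esub> E t" for p t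
    by (simp add: E_def)
  have V_Cons [simp]: "p # t \<in> V \<longleftrightarrow> p \<in> carrier K \<times> lists (carrier G) \<and> t \<in> V" for p t
    by (auto simp: V_def)
  have V_Nil [simp]: "[] \<in> V" by (simp add: V_def)
  have V_induct: "P t"
    if "t \<in> V" "P []" "\<And>c w t. c \<in> carrier K \<Longrightarrow> w \<in> lists (carrier G) \<Longrightarrow> t \<in> V \<Longrightarrow>
         P t \<Longrightarrow> P ((c, w) # t)" for P t
  proof -
    have "t \<in> V \<longrightarrow> P t"
      by (induction t) (auto intro!: that(2,3) simp: in_listsI)
    then show ?thesis using that(1) by blast
  qed
  have A_closed: "x \<in> carrier R" if "x \<in> A" for x
    using that by (auto simp: A_def)
  have A_add: "x \<oplus>\<^bsub>R\<^esub> y \<in> A" if xy: "x \<in> A" "y \<in> A" for x y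
  proof -
    obtain s t where s: "s \<in> V" "x = E s" and t: "t \<in> V" "y = E t"
      using xy by (auto simp: A_def)
    have "E (s @ t) = E s \<oplus>\<^bsub>R\<^esub> E t"
      using s(1) by (rule V_induct) (auto simp: t(1) M.a_assoc)
    moreover have "s @ t \<in> V" using s t by (auto simp: V_def)
    ultimately show ?thesis using s t unfolding A_def by (intro image_eqI[of _ _ "s @ t"]) auto
  qed
  have A_smult: "c \<odot>\<^bsub>R\<^esub> x \<in> A" if c: "c \<in> carrier K" and x: "x \<in> A" for c x
  proof -
    obtain t where t: "t \<in> V" "x = E t" using x by (auto simp: A_def)
    have "c \<odot>\<^bsub>R\<^esub> E t = E (map (\<lambda>(d, w). (c \<otimes>\<^bsub>K\<^esub> d, w)) t) \<and>
          map (\<lambda>(d, w). (c \<otimes>\<^bsub>K\<^esub> d, w)) t \<in> V"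
      using t(1) by (rule V_induct) (auto simp: c smult_r_distr smult_assoc1)
    with t(2) show ?thesis by (auto simp: A_def)
  qed
  have word_A: "word_eval R \<Gamma> w \<in> A" if "w \<in> lists (carrier G)" for w
    unfolding A_def using that by (intro image_eqI[of _ _ "[(\<one>\<^bsub>K\<^esub>, w)]"]) auto
  have zero_A: "\<zero>\<^bsub>R\<^esub> \<in> A"
    unfolding A_def by (intro image_eqI[of _ _ "[]"]) auto
  have word_mult_A: "word_eval R \<Gamma> v \<otimes>\<^bsub>R\<^esub> x \<in> A"
    if v: "v \<in> lists (carrier G)" and x: "x \<in> A" for v x
  proof -
    obtain t where t: "t \<in> V" "x = E t" using x by (auto simp: A_def)
    have "word_eval R \<Gamma> v \<otimes>\<^bsub>R\<^esub> E t \<in> A"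
      using t(1)
    proof (rule V_induct)
      show "word_eval R \<Gamma> v \<otimes>\<^bsub>R\<^esub> E [] \<in> A" using v zero_A by simp
      fix c w t
      assume *: "c \<in> carrier K" "w \<in> lists (carrier G)" "t \<in> V"
        "word_eval R \<Gamma> v \<otimes>\<^bsub>R\<^esub> E t \<in> A"
      then have "word_eval R \<Gamma> v \<otimes>\<^bsub>R\<^esub> E ((c, w) # t) =
          c \<odot>\<^bsub>R\<^esub> word_eval R \<Gamma> (v @ w) \<oplus>\<^bsub>R\<^esub> word_eval R \<Gamma> v \<otimes>\<^bsub>R\<^esub> E t"
        using v by (simp add: r_distr smult_mult_right word_append del: in_lists_conv_set)
      also have "\<dots> \<in> A"
        using * v by (intro A_add A_smult word_A) auto
      finally show "word_eval R \<Gamma> v \<otimes>\<^bsub>R\<^esub> E ((c, w) # t) \<in> A" .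
    qed
    with t(2) show ?thesis by simp
  qed
  have A_mult: "x \<otimes>\<^bsub>R\<^esub> y \<in> A" if x: "x \<in> A" and y: "y \<in> A" for x y
  proof -
    obtain t where t: "t \<in> V" "x = E t" using x by (auto simp: A_def)
    have "E t \<otimes>\<^bsub>R\<^esub> y \<in> A"
      using t(1)
    proof (rule V_induct)
      show "E [] \<otimes>\<^bsub>R\<^esub> y \<in> A" using y zero_A A_closed by simp
      fix c w t
      assume *: "c \<in> carrier K" "w \<in> lists (carrier G)" "t \<in> V" "E t \<otimes>\<^bsub>R\<^esub> y \<in> A"
      then have "E ((c, w) # t) \<otimes>\<^bsub>R\<^esub> y =
          c \<odot>\<^bsub>R\<^esub> (word_eval R \<Gamma> w \<otimes>\<^bsub>R\<^esub> y) \<oplus>\<^bsub>R\<^esub> E t \<otimes>\<^bsub>R\<^esub> y"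
        using A_closed[OF y] by (simp add: l_distr smult_mult_left del: in_lists_conv_set)
      also have "\<dots> \<in> A"
        using * y by (intro A_add A_smult word_mult_A) auto
      finally show "E ((c, w) # t) \<otimes>\<^bsub>R\<^esub> y \<in> A" .
    qed
    with t(2) show ?thesis by simp
  qed
  have one_A: "\<one>\<^bsub>R\<^esub> \<in> A" using word_A[of "[]"] by simp
  have \<Gamma>_A: "\<Gamma> g \<in> A" if "g \<in> carrier G" for g
    using word_A[of "[g]"] that \<Gamma> by simp
  have E_\<phi>: "E (\<phi> x) = x" if "x \<in> A" for x
  proof -
    have "\<exists>t. t \<in> V \<and> E t = x" using that by (auto simp: A_def)
    from someI_ex[OF this] show ?thesis by (simp add: \<phi>_def)
  qed
  have \<phi>_eq: "\<phi> x = \<phi> y \<longleftrightarrow> x = y" if "x \<in> A" "y \<in> A" for x y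
    using E_\<phi>[OF that(1)] E_\<phi>[OF that(2)] by metis
  define T :: "('k, ('k \<times> 'g list) list) module" where
    "T = \<lparr>carrier = \<phi> ` A, monoid.mult = (\<lambda>s t. \<phi> (E s \<otimes>\<^bsub>R\<^esub> E t)),
     one = \<phi> \<one>\<^bsub>R\<^esub>, ring.zero = \<phi> \<zero>\<^bsub>R\<^esub>, ring.add = (\<lambda>s t. \<phi> (E s \<oplus>\<^bsub>R\<^esub> E t)),
     module.smult = (\<lambda>c t. \<phi> (c \<odot>\<^bsub>R\<^esub> E t))\<rparr>"
  have algT: "assoc_algebra K T"
    unfolding T_def
    by (rule assoc_algebra_transport[OF alg _ one_A])
       (use A_closed A_add A_mult A_smult E_\<phi> in auto)
  have \<sigma>: "\<sigma> (g, h) \<in> carrier K" if "g \<in> carrier G" "h \<in> carrier G" for g h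
    using rep that by (auto simp: partial_projective_rep_def)
  note ins = \<Gamma>_A A_mult A_smult \<sigma> zero_A one_A E_\<phi> \<phi>_eq
  have repT: "partial_projective_rep K G T (\<lambda>g. \<phi> (\<Gamma> g)) \<sigma>"
    using rep unfolding partial_projective_rep_def T_def by (auto simp: ins)
  have "\<one>\<^bsub>T\<^esub> \<noteq> \<zero>\<^bsub>T\<^esub>" using nz by (simp add: T_def ins)
  with algT repT show ?thesis unfolding pm_def by blast
qed


section \<open>The infinite dihedral group\<close>

text \<open>
  The group is given by the normal form of its elements: \<open>Rot i\<close> is \<open>a\<^sup>i\<close> and \<open>Ref i\<close> is
  \<open>b a\<^sup>i\<close>, multiplied by means of \<open>a\<^sup>i b = b a\<^sup>-\<^sup>i\<close>. The lemmas below show that it has the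
  presentation with generators \<open>a\<close>, \<open>b\<close> and relations \<open>b\<^sup>2 = 1\<close>, \<open>b a = a\<^sup>-\<^sup>1 b\<close>.
\<close>

datatype dinf = Rot int | Ref int

fun dinf_mult :: "dinf \<Rightarrow> dinf \<Rightarrow> dinf" where
  "dinf_mult (Rot i) (Rot j) = Rot (i + j)"
| "dinf_mult (Rot i) (Ref j) = Ref (j - i)"
| "dinf_mult (Ref i) (Rot j) = Ref (i + j)"
| "dinf_mult (Ref i) (Ref j) = Rot (j - i)"

definition Dinf :: "dinf monoid" where
  "Dinf = \<lparr>carrier = UNIV, monoid.mult = dinf_mult, one = Rot 0\<rparr>"

definition gen_a :: dinf where "gen_a = Rot 1"
definition gen_b :: dinf where "gen_b = Ref 0"

lemma carrier_Dinf [simp]: "carrier Dinf = UNIV"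
  and mult_Dinf: "x \<otimes>\<^bsub>Dinf\<^esub> y = dinf_mult x y"
  and one_Dinf: "\<one>\<^bsub>Dinf\<^esub> = Rot 0"
  by (simp_all add: Dinf_def)

lemma group_Dinf: "group Dinf"
proof (rule groupI)
  fix x y z :: dinf
  show "x \<otimes>\<^bsub>Dinf\<^esub> y \<otimes>\<^bsub>Dinf\<^esub> z = x \<otimes>\<^bsub>Dinf\<^esub> (y \<otimes>\<^bsub>Dinf\<^esub> z)"
    by (cases x; cases y; cases z) (auto simp: mult_Dinf)
  show "\<one>\<^bsub>Dinf\<^esub> \<otimes>\<^bsub>Dinf\<^esub> x = x"
    by (cases x) (auto simp: mult_Dinf one_Dinf)
  have "\<exists>y. dinf_mult y x = Rot 0"
  proof (cases x)
    case (Rot i)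
    then show ?thesis by (intro exI[of _ "Rot (- i)"]) simp
  next
    case (Ref i)
    then show ?thesis by (intro exI[of _ "Ref i"]) simp
  qed
  then show "\<exists>y \<in> carrier Dinf. y \<otimes>\<^bsub>Dinf\<^esub> x = \<one>\<^bsub>Dinf\<^esub>"
    by (simp add: mult_Dinf one_Dinf)
qed auto

interpretation Dinf: group Dinf by (rule group_Dinf)

lemma inv_Dinf: "inv\<^bsub>Dinf\<^esub> (Rot i) = Rot (- i)" "inv\<^bsub>Dinf\<^esub> (Ref i) = Ref i"
  by (rule Dinf.inv_equality; simp add: mult_Dinf one_Dinf)+

lemma a_pow: "gen_a [^]\<^bsub>Dinf\<^esub> (i::int) = Rot i"
proof -
  have nat: "gen_a [^]\<^bsub>Dinf\<^esub> (n::nat) = Rot (int n)" for n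
    by (induction n) (auto simp: mult_Dinf one_Dinf gen_a_def)
  show ?thesis
    by (cases "i < 0") (auto simp: int_pow_def2 nat inv_Dinf)
qed

lemma b_a_pow: "gen_b \<otimes>\<^bsub>Dinf\<^esub> gen_a [^]\<^bsub>Dinf\<^esub> (i::int) = Ref i"
  by (simp add: a_pow mult_Dinf gen_b_def)

lemma Dinf_relations:
  "gen_b [^]\<^bsub>Dinf\<^esub> (2::nat) = \<one>\<^bsub>Dinf\<^esub>"
  "gen_b \<otimes>\<^bsub>Dinf\<^esub> gen_a = inv\<^bsub>Dinf\<^esub> gen_a \<otimes>\<^bsub>Dinf\<^esub> gen_b"
  by (simp_all add: numeral_2_eq_2 mult_Dinf one_Dinf gen_a_def gen_b_def inv_Dinf)

lemma Dinf_generate: "generate Dinf {gen_a, gen_b} = carrier Dinf"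
proof -
  let ?H = "generate Dinf {gen_a, gen_b}"
  have H: "subgroup ?H Dinf" by (rule Dinf.generate_is_subgroup) simp
  have "gen_a \<in> ?H" and b: "gen_b \<in> ?H" by (auto intro: generate.incl)
  then have a: "gen_a [^]\<^bsub>Dinf\<^esub> i \<in> ?H" for i :: int
    using Dinf.subgroup_int_pow_closed[OF H] by blast
  have "x \<in> ?H" for x
    using a b subgroup.m_closed[OF H b a] by (cases x) (auto simp: a_pow[symmetric] b_a_pow[symmetric])
  then show ?thesis by auto
qed

text \<open>Universal property; uniqueness of the homomorphism follows from \<open>Dinf_generate\<close>.\<close>

lemma Dinf_universal:
  fixes H (structure)
  assumes "group H" and x: "x \<in> carrier H" and y: "y \<in> carrier H"
    and yy: "y [^] (2::nat) = \<one>" and yx: "y \<otimes> x = inv x \<otimes> y"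
  shows "\<exists>h \<in> hom Dinf H. h gen_a = x \<and> h gen_b = y"
proof -
  interpret group H by fact
  have yy': "y \<otimes> y = \<one>" using yy y by (simp add: numeral_2_eq_2)
  have conj: "y \<otimes> x [^] i = x [^] (- i) \<otimes> y" for i :: int
  proof -
    have 1: "y \<otimes> x [^] n = inv x [^] n \<otimes> y" for n :: nat
    proof (induction n)
      case (Suc n)
      have "y \<otimes> x [^] Suc n = (y \<otimes> x [^] n) \<otimes> x" using x y by (simp add: m_assoc)
      also have "\<dots> = inv x [^] n \<otimes> (y \<otimes> x)" using x y Suc by (simp add: m_assoc)
      also have "\<dots> = inv x [^] Suc n \<otimes> y" using x y yx by (simp add: m_assoc)
      finally show ?case .
    qed (use y in simp)
    have nat: "y \<otimes> x [^] int n = x [^] (- int n) \<otimes> y" for n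
      using 1[of n] x by (simp add: int_pow_neg int_pow_int nat_pow_inv)
    show ?thesis
    proof (cases "i \<ge> 0")
      case True
      then show ?thesis using nat[of "nat i"] by simp
    next
      case False
      define n where "n = nat (- i)"
      have i: "i = - int n" using False by (simp add: n_def)
      have "y \<otimes> (y \<otimes> x [^] int n) \<otimes> y = y \<otimes> (x [^] i \<otimes> y) \<otimes> y" using nat[of n] i by simp
      moreover have "y \<otimes> (y \<otimes> x [^] int n) \<otimes> y = x [^] int n \<otimes> y"
        using x y yy' by (simp add: m_assoc[symmetric])
      moreover have "y \<otimes> (x [^] i \<otimes> y) \<otimes> y = y \<otimes> x [^] i"
        using x y yy' by (simp add: m_assoc)
      ultimately show ?thesis using i by simp
    qed
  qed
  have conj': "x [^] i \<otimes> y = y \<otimes> x [^] (- i)" for i :: int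
    using conj[of "- i"] by simp
  have powd: "x [^] (- i) \<otimes> x [^] j = x [^] (j - i)" for i j :: int
    using int_pow_mult[OF x, of "- i" j] by simp
  define h where "h d = (case d of Rot i \<Rightarrow> x [^] i | Ref i \<Rightarrow> y \<otimes> x [^] i)" for d
  have "h \<in> hom Dinf H"
  proof (rule homI)
    fix d e
    show "h d \<in> carrier H" using x y by (cases d) (auto simp: h_def)
    show "h (d \<otimes>\<^bsub>Dinf\<^esub> e) = h d \<otimes> h e"
    proof (cases d)
      case d: (Rot i)
      show ?thesis
      proof (cases e)
        case (Rot j)
        then show ?thesis using d x by (simp add: h_def mult_Dinf int_pow_mult)
      next
        case (Ref j)
        have "x [^] i \<otimes> (y \<otimes> x [^] j) = y \<otimes> x [^] (- i) \<otimes> x [^] j"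
          using x y conj'[of i] by (simp add: m_assoc[symmetric])
        also have "\<dots> = y \<otimes> x [^] (j - i)"
          using x y by (simp add: m_assoc powd)
        finally show ?thesis using Ref d by (simp add: h_def mult_Dinf)
      qed
    next
      case d: (Ref i)
      show ?thesis
      proof (cases e)
        case (Rot j)
        then show ?thesis using d x y by (simp add: h_def mult_Dinf int_pow_mult m_assoc)
      next
        case (Ref j)
        have "y \<otimes> x [^] i \<otimes> (y \<otimes> x [^] j) = x [^] (- i) \<otimes> (y \<otimes> y) \<otimes> x [^] j"
          using x y conj[of i] by (simp add: m_assoc[symmetric])
        also have "\<dots> = x [^] (j - i)"
          using x y yy' by (simp add: powd)
        finally show ?thesis using Ref d by (simp add: h_def mult_Dinf)
      qed
    qed
  qed
  moreover have "h gen_a = x" "h gen_b = y" using x y by (auto simp: h_def gen_a_def gen_b_def)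
  ultimately show ?thesis by blast
qed


section \<open>The parameters and their factor sets\<close>

definition zero_one :: "nat monoid" where
  "zero_one = \<lparr>carrier = {0, 1}, monoid.mult = (*), one = 1\<rparr>"

abbreviation posints :: "int set" where "posints \<equiv> {0<..}"

text \<open>
  A function on a disjoint union is represented by the pair of its restrictions, and a function
  on a subset of a type is extensional, i.e. \<open>undefined\<close> outside that subset.
\<close>

type_synonym nu = "(int \<Rightarrow> nat) \<times> (int \<Rightarrow> nat)"
type_synonym omega = "(int \<times> int \<Rightarrow> nat) \<times> (int \<times> int \<Rightarrow> nat)"

definition nu_semigroup :: "nu monoid" where
  "nu_semigroup = product_group posints (\<lambda>_. zero_one) \<times>\<times> product_group UNIV (\<lambda>_. zero_one)"

definition omega_semigroup :: "omega monoid" where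
  "omega_semigroup = product_group (posints \<times> posints) (\<lambda>_. zero_one)
     \<times>\<times> product_group (posints \<times> UNIV) (\<lambda>_. zero_one)"

definition S_set :: "nu \<Rightarrow> dinf set" where
  "S_set \<nu> = (\<Union>i \<in> {i \<in> posints. fst \<nu> i = 0}. {gen_a [^]\<^bsub>Dinf\<^esub> i, gen_a [^]\<^bsub>Dinf\<^esub> (- i)})
     \<union> {gen_b \<otimes>\<^bsub>Dinf\<^esub> gen_a [^]\<^bsub>Dinf\<^esub> i | i::int. snd \<nu> i = 0}"

definition sigma_nu :: "('k, 'm) ring_scheme \<Rightarrow> nu \<Rightarrow> dinf \<times> dinf \<Rightarrow> 'k" where
  "sigma_nu K \<nu> = (\<lambda>(x, y).
     if {x, y, x \<otimes>\<^bsub>Dinf\<^esub> y} \<inter> S_set \<nu> \<noteq> {} then \<zero>\<^bsub>K\<^esub> else \<one>\<^bsub>K\<^esub>)"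

definition C_set :: "dinf \<Rightarrow> dinf \<Rightarrow> (dinf \<times> dinf) set" where
  "C_set x y =
    {(x, y),
     (inv\<^bsub>Dinf\<^esub> y \<otimes>\<^bsub>Dinf\<^esub> inv\<^bsub>Dinf\<^esub> x, x),
     (y, inv\<^bsub>Dinf\<^esub> y \<otimes>\<^bsub>Dinf\<^esub> inv\<^bsub>Dinf\<^esub> x),
     (inv\<^bsub>Dinf\<^esub> y, inv\<^bsub>Dinf\<^esub> x),
     (inv\<^bsub>Dinf\<^esub> x, x \<otimes>\<^bsub>Dinf\<^esub> y),
     (x \<otimes>\<^bsub>Dinf\<^esub> y, inv\<^bsub>Dinf\<^esub> y)}"

definition W_set :: "omega \<Rightarrow> (dinf \<times> dinf) set" where
  "W_set \<omega> =
     {(gen_a [^]\<^bsub>Dinf\<^esub> n, gen_a [^]\<^bsub>Dinf\<^esub> m) | n m. (n, m) \<in> posints \<times> posints \<and> fst \<omega> (n, m) = 0}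
     \<union> {(gen_a [^]\<^bsub>Dinf\<^esub> i, gen_b \<otimes>\<^bsub>Dinf\<^esub> gen_a [^]\<^bsub>Dinf\<^esub> j) | i j.
          (i, j) \<in> posints \<times> UNIV \<and> snd \<omega> (i, j) = 0}"

definition sigma_omega :: "('k, 'm) ring_scheme \<Rightarrow> omega \<Rightarrow> dinf \<times> dinf \<Rightarrow> 'k" where
  "sigma_omega K \<omega> = (\<lambda>(x, y). if C_set x y \<inter> W_set \<omega> \<noteq> {} then \<zero>\<^bsub>K\<^esub> else \<one>\<^bsub>K\<^esub>)"

end

theory Submission
  imports Defs
begin

text \<open>
  For any group \<open>G\<close>, the idempotent factor sets are the indicators of the sets \<open>D \<subseteq> G \<times> G\<close> that contain
  \<open>(1, 1)\<close> and, with \<open>(x, y)\<close>, also \<open>(x\<^sup>-\<^sup>1, xy)\<close>, \<open>(xy, y\<^sup>-\<^sup>1)\<close> and \<open>(x, 1)\<close>. The first two maps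
  generate an action of \<open>S\<^sub>3\<close> whose orbits are the sets \<open>C\<^bsub>(x,y)\<^esub>\<close>. To realise such a \<open>D\<close>, let \<open>G\<close> act
  by partial left translations on the disjoint union of the triangles \<open>{1, y, xy}\<close> with \<open>(x, y) \<in> D\<close>,
  and hence on the functions on that union. In the infinite dihedral group every orbit either
  contains some \<open>(x, 1)\<close>, and is then governed by \<open>\<nu>\<close>, or a pair \<open>(a\<^sup>n, a\<^sup>m)\<close> or \<open>(a\<^sup>n, ba\<^sup>j)\<close> with
  \<open>n, m > 0\<close>, and is then governed by \<open>\<omega>\<close>.
\<close>

section \<open>The endomorphism algebra of a module\<close>

text \<open>Endomorphisms are extensional on the carrier of \<open>M\<close>, so that agreement on
  the carrier is equality of functions and the algebra laws can hold as plain equations. The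
  operations are restricted to the carrier for the same reason.\<close>

definition endo_algebra ::
  "('k, 'm) ring_scheme \<Rightarrow> ('k, 'v, 'l) module_scheme \<Rightarrow> ('k, 'v \<Rightarrow> 'v) module" where
  "endo_algebra K M = \<lparr>carrier = {f \<in> carrier M \<rightarrow>\<^sub>E carrier M.
       (\<forall>x \<in> carrier M. \<forall>y \<in> carrier M. f (x \<oplus>\<^bsub>M\<^esub> y) = f x \<oplus>\<^bsub>M\<^esub> f y) \<and>
       (\<forall>c \<in> carrier K. \<forall>x \<in> carrier M. f (c \<odot>\<^bsub>M\<^esub> x) = c \<odot>\<^bsub>M\<^esub> f x)},
     monoid.mult = compose (carrier M), one = (\<lambda>x \<in> carrier M. x),
     ring.zero = (\<lambda>x \<in> carrier M. \<zero>\<^bsub>M\<^esub>), ring.add = (\<lambda>f g. \<lambda>x \<in> carrier M. f x \<oplus>\<^bsub>M\<^esub> g x),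
     module.smult = (\<lambda>c f. \<lambda>x \<in> carrier M. c \<odot>\<^bsub>M\<^esub> f x)\<rparr>"

lemma assoc_algebra_endo_algebra:
  assumes "module K M"
  shows "assoc_algebra K (endo_algebra K M)"
proof -
  interpret module K M by fact
  let ?E = "endo_algebra K M"
  have mem: "f x \<in> carrier M" if "f \<in> carrier ?E" "x \<in> carrier M" for f x
    using that by (auto simp: endo_algebra_def)
  have add: "f (x \<oplus>\<^bsub>M\<^esub> y) = f x \<oplus>\<^bsub>M\<^esub> f y"
    if "f \<in> carrier ?E" "x \<in> carrier M" "y \<in> carrier M" for f x y
    using that by (auto simp: endo_algebra_def)
  have smult: "f (c \<odot>\<^bsub>M\<^esub> x) = c \<odot>\<^bsub>M\<^esub> f x"
    if "f \<in> carrier ?E" "c \<in> carrier K" "x \<in> carrier M" for f c x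
    using that by (auto simp: endo_algebra_def)
  have ext: "f = g"
    if "f \<in> extensional (carrier M)" "g \<in> extensional (carrier M)"
      "\<And>x. x \<in> carrier M \<Longrightarrow> f x = g x" for f g :: "'c \<Rightarrow> 'c"
    using that by (rule extensionalityI)
  have exE: "f \<in> extensional (carrier M)" if "f \<in> carrier ?E" for f
    using that by (auto simp: endo_algebra_def PiE_def)
  have smult_comm: "c \<odot>\<^bsub>M\<^esub> (d \<odot>\<^bsub>M\<^esub> x) = d \<odot>\<^bsub>M\<^esub> (c \<odot>\<^bsub>M\<^esub> x)"
    if "c \<in> carrier K" "d \<in> carrier K" "x \<in> carrier M" for c d x
    using that by (simp add: smult_assoc1[symmetric] R.m_comm)
  have mult_E: "(f \<otimes>\<^bsub>?E\<^esub> g) = compose (carrier M) f g" for f g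
    by (simp add: endo_algebra_def)
  have add_E: "(f \<oplus>\<^bsub>?E\<^esub> g) = (\<lambda>x \<in> carrier M. f x \<oplus>\<^bsub>M\<^esub> g x)" for f g
    by (simp add: endo_algebra_def)
  have smult_E: "(c \<odot>\<^bsub>?E\<^esub> g) = (\<lambda>x \<in> carrier M. c \<odot>\<^bsub>M\<^esub> g x)" for c g
    by (simp add: endo_algebra_def)
  have one_E: "\<one>\<^bsub>?E\<^esub> = (\<lambda>x \<in> carrier M. x)" and zero_E: "\<zero>\<^bsub>?E\<^esub> = (\<lambda>x \<in> carrier M. \<zero>\<^bsub>M\<^esub>)"
    by (simp_all add: endo_algebra_def)
  have memI: "f \<in> carrier ?E"
    if "f \<in> extensional (carrier M)" "\<And>x. x \<in> carrier M \<Longrightarrow> f x \<in> carrier M"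
      "\<And>x y. x \<in> carrier M \<Longrightarrow> y \<in> carrier M \<Longrightarrow> f (x \<oplus>\<^bsub>M\<^esub> y) = f x \<oplus>\<^bsub>M\<^esub> f y"
      "\<And>c x. c \<in> carrier K \<Longrightarrow> x \<in> carrier M \<Longrightarrow> f (c \<odot>\<^bsub>M\<^esub> x) = c \<odot>\<^bsub>M\<^esub> f x" for f
    using that by (auto simp: endo_algebra_def PiE_def)
  have mult_mem: "f \<otimes>\<^bsub>?E\<^esub> g \<in> carrier ?E" if "f \<in> carrier ?E" "g \<in> carrier ?E" for f g
    using that by (intro memI) (auto simp: mult_E compose_def mem add smult)
  have add_mem: "f \<oplus>\<^bsub>?E\<^esub> g \<in> carrier ?E" if "f \<in> carrier ?E" "g \<in> carrier ?E" for f g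
    using that
    by (intro memI) (auto simp: add_E mem add smult M.a_ac smult_r_distr)
  have smult_mem: "c \<odot>\<^bsub>?E\<^esub> f \<in> carrier ?E" if "c \<in> carrier K" "f \<in> carrier ?E" for c f
    using that
    by (intro memI) (auto simp: smult_E mem add smult smult_r_distr smult_comm)
  have one_mem: "\<one>\<^bsub>?E\<^esub> \<in> carrier ?E" by (intro memI) (auto simp: one_E)
  have zero_mem: "\<zero>\<^bsub>?E\<^esub> \<in> carrier ?E" by (intro memI) (auto simp: zero_E)
  note closed = mult_mem add_mem smult_mem one_mem zero_mem
  have ag: "abelian_group ?E"
  proof (rule abelian_groupI)
    fix f assume f: "f \<in> carrier ?E"
    \<comment> \<open>The additive inverse is written as the scalar multiple by -1, which closure
      under scalars already puts in the algebra.\<close>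
    show "\<exists>g \<in> carrier ?E. g \<oplus>\<^bsub>?E\<^esub> f = \<zero>\<^bsub>?E\<^esub>"
    proof
      show "(\<ominus>\<^bsub>K\<^esub> \<one>\<^bsub>K\<^esub>) \<odot>\<^bsub>?E\<^esub> f \<in> carrier ?E" using f by (simp add: smult_mem)
      show "(\<ominus>\<^bsub>K\<^esub> \<one>\<^bsub>K\<^esub>) \<odot>\<^bsub>?E\<^esub> f \<oplus>\<^bsub>?E\<^esub> f = \<zero>\<^bsub>?E\<^esub>"
        using f by (intro ext) (auto simp: add_E smult_E zero_E mem smult_l_minus M.l_neg)
    qed
  next
    fix f g h assume f: "f \<in> carrier ?E" "g \<in> carrier ?E" "h \<in> carrier ?E"
    show "f \<oplus>\<^bsub>?E\<^esub> g \<oplus>\<^bsub>?E\<^esub> h = f \<oplus>\<^bsub>?E\<^esub> (g \<oplus>\<^bsub>?E\<^esub> h)"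
      using f by (intro ext) (auto simp: add_E mem M.a_assoc)
  next
    fix f g assume f: "f \<in> carrier ?E" "g \<in> carrier ?E"
    show "f \<oplus>\<^bsub>?E\<^esub> g = g \<oplus>\<^bsub>?E\<^esub> f"
      using f by (intro ext) (auto simp: add_E mem M.a_comm)
  next
    fix f assume f: "f \<in> carrier ?E"
    show "\<zero>\<^bsub>?E\<^esub> \<oplus>\<^bsub>?E\<^esub> f = f"
      using f exE[OF f] by (intro ext) (auto simp: add_E zero_E mem)
  qed (auto simp: closed)
  have mon: "Group.monoid ?E"
  proof (rule monoidI)
    fix f g h assume f: "f \<in> carrier ?E" "g \<in> carrier ?E" "h \<in> carrier ?E"
    show "f \<otimes>\<^bsub>?E\<^esub> g \<otimes>\<^bsub>?E\<^esub> h = f \<otimes>\<^bsub>?E\<^esub> (g \<otimes>\<^bsub>?E\<^esub> h)"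
      using f by (intro ext) (auto simp: mult_E compose_def mem)
  next
    fix f assume f: "f \<in> carrier ?E"
    show "\<one>\<^bsub>?E\<^esub> \<otimes>\<^bsub>?E\<^esub> f = f" "f \<otimes>\<^bsub>?E\<^esub> \<one>\<^bsub>?E\<^esub> = f"
      using f exE[OF f] by (intro ext; auto simp: mult_E one_E compose_def mem)+
  qed (auto simp: closed)
  have ring: "ring ?E"
  proof (rule ringI[OF ag mon])
    fix f g h assume f: "f \<in> carrier ?E" "g \<in> carrier ?E" "h \<in> carrier ?E"
    show "(f \<oplus>\<^bsub>?E\<^esub> g) \<otimes>\<^bsub>?E\<^esub> h = f \<otimes>\<^bsub>?E\<^esub> h \<oplus>\<^bsub>?E\<^esub> g \<otimes>\<^bsub>?E\<^esub> h"
      using f by (intro ext) (auto simp: mult_E add_E compose_def mem)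
    show "h \<otimes>\<^bsub>?E\<^esub> (f \<oplus>\<^bsub>?E\<^esub> g) = h \<otimes>\<^bsub>?E\<^esub> f \<oplus>\<^bsub>?E\<^esub> h \<otimes>\<^bsub>?E\<^esub> g"
      using f by (intro ext) (auto simp: mult_E add_E compose_def mem add)
  qed
  have mod: "module K ?E"
  proof (rule moduleI[OF R.is_cring ag])
    fix c d f g assume c: "c \<in> carrier K" "d \<in> carrier K" "f \<in> carrier ?E" "g \<in> carrier ?E"
    show "(c \<oplus>\<^bsub>K\<^esub> d) \<odot>\<^bsub>?E\<^esub> f = c \<odot>\<^bsub>?E\<^esub> f \<oplus>\<^bsub>?E\<^esub> d \<odot>\<^bsub>?E\<^esub> f"
      using c by (intro ext) (auto simp: smult_E add_E mem smult_l_distr)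
    show "c \<odot>\<^bsub>?E\<^esub> (f \<oplus>\<^bsub>?E\<^esub> g) = c \<odot>\<^bsub>?E\<^esub> f \<oplus>\<^bsub>?E\<^esub> c \<odot>\<^bsub>?E\<^esub> g"
      using c by (intro ext) (auto simp: smult_E add_E mem smult_r_distr)
    show "(c \<otimes>\<^bsub>K\<^esub> d) \<odot>\<^bsub>?E\<^esub> f = c \<odot>\<^bsub>?E\<^esub> (d \<odot>\<^bsub>?E\<^esub> f)"
      using c by (intro ext) (auto simp: smult_E mem smult_assoc1)
  next
    fix f assume "f \<in> carrier ?E"
    then show "\<one>\<^bsub>K\<^esub> \<odot>\<^bsub>?E\<^esub> f = f"
      using exE by (intro ext) (auto simp: smult_E mem)
  qed (rule smult_mem)
  show ?thesis
  proof (intro assoc_algebra.intro mod ring assoc_algebra_axioms.intro)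
    fix c f g assume c: "c \<in> carrier K" "f \<in> carrier ?E" "g \<in> carrier ?E"
    show "(c \<odot>\<^bsub>?E\<^esub> f) \<otimes>\<^bsub>?E\<^esub> g = c \<odot>\<^bsub>?E\<^esub> (f \<otimes>\<^bsub>?E\<^esub> g)"
      using c by (intro ext) (auto simp: mult_E smult_E compose_def mem)
    show "f \<otimes>\<^bsub>?E\<^esub> (c \<odot>\<^bsub>?E\<^esub> g) = c \<odot>\<^bsub>?E\<^esub> (f \<otimes>\<^bsub>?E\<^esub> g)"
      using c by (intro ext) (auto simp: mult_E smult_E compose_def mem smult)
  qed
qed

definition fun_module :: "('k, 'm) ring_scheme \<Rightarrow> 'x set \<Rightarrow> ('k, 'x \<Rightarrow> 'k) module" where
  "fun_module K Y = \<lparr>carrier = Y \<rightarrow>\<^sub>E carrier K, monoid.mult = undefined, one = undefined,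
     ring.zero = (\<lambda>x \<in> Y. \<zero>\<^bsub>K\<^esub>), ring.add = (\<lambda>v w. \<lambda>x \<in> Y. v x \<oplus>\<^bsub>K\<^esub> w x),
     module.smult = (\<lambda>c v. \<lambda>x \<in> Y. c \<otimes>\<^bsub>K\<^esub> v x)\<rparr>"

lemma module_fun_module:
  assumes "cring K"
  shows "module K (fun_module K Y)"
proof -
  interpret cring K by fact
  let ?V = "fun_module K Y"
  have carrier: "carrier ?V = Y \<rightarrow>\<^sub>E carrier K" by (simp add: fun_module_def)
  have add: "v \<oplus>\<^bsub>?V\<^esub> w = (\<lambda>x \<in> Y. v x \<oplus>\<^bsub>K\<^esub> w x)" for v w by (simp add: fun_module_def)
  have zero: "\<zero>\<^bsub>?V\<^esub> = (\<lambda>x \<in> Y. \<zero>\<^bsub>K\<^esub>)" by (simp add: fun_module_def)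
  have smult: "c \<odot>\<^bsub>?V\<^esub> v = (\<lambda>x \<in> Y. c \<otimes>\<^bsub>K\<^esub> v x)" for c v by (simp add: fun_module_def)
  have mem: "v x \<in> carrier K" if "v \<in> carrier ?V" "x \<in> Y" for v x
    using that by (auto simp: carrier)
  have eqI: "v = w" if "v \<in> carrier ?V" "w \<in> carrier ?V" "\<And>x. x \<in> Y \<Longrightarrow> v x = w x" for v w
    using that by (intro extensionalityI[of _ Y]) (auto simp: carrier PiE_def)
  have add_closed: "v \<oplus>\<^bsub>?V\<^esub> w \<in> carrier ?V" if "v \<in> carrier ?V" "w \<in> carrier ?V" for v w
    using that by (auto simp: carrier add PiE_mem)
  have smult_closed: "c \<odot>\<^bsub>?V\<^esub> v \<in> carrier ?V" if "c \<in> carrier K" "v \<in> carrier ?V" for v c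
    using that by (auto simp: carrier smult PiE_mem)
  have zero_closed: "\<zero>\<^bsub>?V\<^esub> \<in> carrier ?V" by (auto simp: carrier zero)
  have ag: "abelian_group ?V"
  proof (rule abelian_groupI)
    fix u v w assume uvw: "u \<in> carrier ?V" "v \<in> carrier ?V" "w \<in> carrier ?V"
    show "u \<oplus>\<^bsub>?V\<^esub> v \<oplus>\<^bsub>?V\<^esub> w = u \<oplus>\<^bsub>?V\<^esub> (v \<oplus>\<^bsub>?V\<^esub> w)"
      by (rule eqI) (simp_all add: uvw add_closed, simp add: add a_assoc mem uvw)
  next
    fix v w assume vw: "v \<in> carrier ?V" "w \<in> carrier ?V"
    show "v \<oplus>\<^bsub>?V\<^esub> w \<in> carrier ?V" by (rule add_closed[OF vw])
    show "v \<oplus>\<^bsub>?V\<^esub> w = w \<oplus>\<^bsub>?V\<^esub> v"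
      by (rule eqI) (simp_all add: vw add_closed, simp add: add a_comm mem vw)
  next
    fix v assume v: "v \<in> carrier ?V"
    show "\<zero>\<^bsub>?V\<^esub> \<oplus>\<^bsub>?V\<^esub> v = v"
      by (rule eqI) (simp_all add: v add_closed zero_closed, simp add: add zero mem v)
    show "\<exists>w \<in> carrier ?V. w \<oplus>\<^bsub>?V\<^esub> v = \<zero>\<^bsub>?V\<^esub>"
    proof
      show w: "(\<ominus>\<^bsub>K\<^esub> \<one>\<^bsub>K\<^esub>) \<odot>\<^bsub>?V\<^esub> v \<in> carrier ?V" by (simp add: smult_closed v)
      show "(\<ominus>\<^bsub>K\<^esub> \<one>\<^bsub>K\<^esub>) \<odot>\<^bsub>?V\<^esub> v \<oplus>\<^bsub>?V\<^esub> v = \<zero>\<^bsub>?V\<^esub>"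
        by (rule eqI[OF add_closed[OF w v] zero_closed])
           (simp add: add zero smult l_minus l_neg mem[OF v])
    qed
  qed (rule zero_closed)
  show ?thesis
  proof (rule moduleI[OF assms ag])
    fix c d v w
    assume c: "c \<in> carrier K" "d \<in> carrier K" and v: "v \<in> carrier ?V" "w \<in> carrier ?V"
    note cv = c v smult_closed add_closed
    show "(c \<oplus>\<^bsub>K\<^esub> d) \<odot>\<^bsub>?V\<^esub> v = c \<odot>\<^bsub>?V\<^esub> v \<oplus>\<^bsub>?V\<^esub> d \<odot>\<^bsub>?V\<^esub> v"
      by (rule eqI) (simp_all add: cv, simp add: add smult l_distr mem cv)
    show "c \<odot>\<^bsub>?V\<^esub> (v \<oplus>\<^bsub>?V\<^esub> w) = c \<odot>\<^bsub>?V\<^esub> v \<oplus>\<^bsub>?V\<^esub> c \<odot>\<^bsub>?V\<^esub> w"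
      by (rule eqI) (simp_all add: cv, simp add: add smult r_distr mem cv)
    show "(c \<otimes>\<^bsub>K\<^esub> d) \<odot>\<^bsub>?V\<^esub> v = c \<odot>\<^bsub>?V\<^esub> (d \<odot>\<^bsub>?V\<^esub> v)"
      by (rule eqI) (simp_all add: cv, simp add: smult m_assoc mem cv)
  next
    fix v assume v: "v \<in> carrier ?V"
    show "\<one>\<^bsub>K\<^esub> \<odot>\<^bsub>?V\<^esub> v = v"
      by (rule eqI) (simp_all add: v smult_closed, simp add: smult mem v)
  qed (rule smult_closed)
qed


section \<open>Idempotent factor sets of a group\<close>

text \<open>The function is cut off outside \<open>carrier G \<times> carrier G\<close> because the
  elements of \<open>pm K G\<close> are extensional there.\<close>

definition support_indicator :: "('k, 'm) ring_scheme \<Rightarrow> ('g, 'n) monoid_scheme \<Rightarrow>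
  ('g \<times> 'g) set \<Rightarrow> 'g \<times> 'g \<Rightarrow> 'k" where
  "support_indicator K G D =
     (\<lambda>p \<in> carrier G \<times> carrier G. if p \<in> D then \<one>\<^bsub>K\<^esub> else \<zero>\<^bsub>K\<^esub>)"

text \<open>On functions on the disjoint union of \<A>, let g send v to the function whose value at
  (A, s) is v (A, g^-1 s), or 0 if g^-1 s leaves A. The product of the operators of g and h is
  nonzero exactly if some A contains a path s, hs, ghs, which is the condition defining
  \<open>D\<close>.\<close>

lemma triangle_indicator_in_pm:
  fixes K :: "('k, 'm) ring_scheme" and G :: "('g, 'n) monoid_scheme" (structure)
  assumes K: "cring K" and K1: "\<one>\<^bsub>K\<^esub> \<noteq> \<zero>\<^bsub>K\<^esub>" and G: "group G"
    and sub: "\<And>A. A \<in> \<A> \<Longrightarrow> A \<subseteq> carrier G" and ne: "A0 \<in> \<A>" "s0 \<in> A0"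
    and D: "\<And>g h. g \<in> carrier G \<Longrightarrow> h \<in> carrier G \<Longrightarrow>
      (g, h) \<in> D \<longleftrightarrow> (\<exists>A \<in> \<A>. \<exists>s \<in> A. h \<otimes> s \<in> A \<and> g \<otimes> (h \<otimes> s) \<in> A)"
  shows "support_indicator K G D \<in> pm K G"
proof -
  interpret K: cring K by fact
  interpret G: group G by fact
  define Y where "Y = Sigma \<A> id"
  define V where "V = fun_module K Y"
  interpret V: module K V unfolding V_def by (rule module_fun_module[OF K])
  define R where "R = endo_algebra K V"
  interpret assoc_algebra K R unfolding R_def by (rule assoc_algebra_endo_algebra) unfold_locales
  have Y: "(A, s) \<in> Y \<longleftrightarrow> A \<in> \<A> \<and> s \<in> A" for A s by (simp add: Y_def)
  have V: "carrier V = Y \<rightarrow>\<^sub>E carrier K" by (simp add: V_def fun_module_def)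
  have cancel: "inv x \<otimes> (x \<otimes> y) = y" "x \<otimes> (inv x \<otimes> y) = y"
    if "x \<in> carrier G" "y \<in> carrier G" for x y
    using that by (simp_all add: G.m_assoc[symmetric])
  have inG: "s \<in> carrier G" if "A \<in> \<A>" "s \<in> A" for A s using sub that by blast
  \<comment> \<open>The operators with a side condition \<open>P\<close> are closed under products, unlike the partial
    translations \<open>\<Gamma> g\<close> themselves.\<close>
  define \<tau> where "\<tau> P g = (\<lambda>v \<in> carrier V. \<lambda>(A, s) \<in> Y.
      if P A s \<and> inv g \<otimes> s \<in> A then v (A, inv g \<otimes> s) else \<zero>\<^bsub>K\<^esub>)"
    for P :: "'g set \<Rightarrow> 'g \<Rightarrow> bool" and g
  define \<Gamma> where "\<Gamma> = \<tau> (\<lambda>_ _. True)"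
  have \<tau>_V: "\<tau> P g v \<in> carrier V" if "v \<in> carrier V" for P g v
    using that by (auto simp: \<tau>_def V Y)
  have \<tau>_mem: "\<tau> P g \<in> carrier R" for P g
    unfolding R_def endo_algebra_def
    by (auto simp: \<tau>_V)
       (auto simp: \<tau>_def V_def fun_module_def Y intro!: ext)
  have \<tau>_mult: "\<tau> P g \<otimes>\<^bsub>R\<^esub> \<tau> Q h =
      \<tau> (\<lambda>A s. P A s \<and> inv g \<otimes> s \<in> A \<and> Q A (inv g \<otimes> s)) (g \<otimes> h)"
    if "g \<in> carrier G" "h \<in> carrier G" for P Q g h
  proof (rule ext)
    fix v
    show "(\<tau> P g \<otimes>\<^bsub>R\<^esub> \<tau> Q h) v =
      \<tau> (\<lambda>A s. P A s \<and> inv g \<otimes> s \<in> A \<and> Q A (inv g \<otimes> s)) (g \<otimes> h) v"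
    proof (cases "v \<in> carrier V")
      case True
      then show ?thesis using that \<tau>_V[OF True, of Q h]
        by (auto simp: R_def endo_algebra_def compose_def \<tau>_def Y G.inv_mult_group G.m_assoc inG
            intro!: ext)
    next
      case False
      then show ?thesis by (simp add: R_def endo_algebra_def compose_def \<tau>_def)
    qed
  qed
  have \<tau>_zero: "\<tau> P g = \<zero>\<^bsub>R\<^esub> \<longleftrightarrow> (\<forall>A \<in> \<A>. \<forall>s \<in> A. \<not> (P A s \<and> inv g \<otimes> s \<in> A))" for P g
  proof
    assume z: "\<tau> P g = \<zero>\<^bsub>R\<^esub>"
    \<comment> \<open>The constant function 1 detects every point at which the operator does not
      vanish, since 1 and 0 differ in \<open>K\<close>.\<close>
    have "(\<lambda>_ \<in> Y. \<one>\<^bsub>K\<^esub>) \<in> carrier V" by (auto simp: V)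
    then have "\<tau> P g (\<lambda>_ \<in> Y. \<one>\<^bsub>K\<^esub>) = \<zero>\<^bsub>V\<^esub>" by (simp add: z) (simp add: R_def endo_algebra_def)
    then have *: "\<tau> P g (\<lambda>_ \<in> Y. \<one>\<^bsub>K\<^esub>) p = (\<lambda>_ \<in> Y. \<zero>\<^bsub>K\<^esub>) p" for p
      by (simp add: V_def fun_module_def)
    show "\<forall>A \<in> \<A>. \<forall>s \<in> A. \<not> (P A s \<and> inv g \<otimes> s \<in> A)"
    proof (intro ballI)
      fix A s assume "A \<in> \<A>" "s \<in> A"
      then show "\<not> (P A s \<and> inv g \<otimes> s \<in> A)"
        using *[of "(A, s)"] K1 by (auto simp: \<tau>_def V Y split: if_splits)
    qed
  next
    assume "\<forall>A \<in> \<A>. \<forall>s \<in> A. \<not> (P A s \<and> inv g \<otimes> s \<in> A)"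
    then show "\<tau> P g = \<zero>\<^bsub>R\<^esub>"
      by (auto simp: \<tau>_def R_def endo_algebra_def V_def fun_module_def Y intro!: ext)
  qed
  have \<tau>_cong: "\<tau> P g = \<tau> Q g"
    if "\<And>A s. A \<in> \<A> \<Longrightarrow> s \<in> A \<Longrightarrow> inv g \<otimes> s \<in> A \<Longrightarrow> P A s \<longleftrightarrow> Q A s" for P Q g
    unfolding \<tau>_def using that by (auto simp: Y intro!: ext)
  have one: "\<Gamma> \<one> = \<one>\<^bsub>R\<^esub>"
  proof (rule ext)
    fix v
    show "\<Gamma> \<one> v = \<one>\<^bsub>R\<^esub> v"
    proof (cases "v \<in> carrier V")
      case True
      then have "v p = undefined" if "p \<notin> Y" for p using that by (auto simp: V)
      then have "\<Gamma> \<one> v p = v p" for p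
        using True by (cases p; cases "p \<in> Y") (auto simp: \<Gamma>_def \<tau>_def Y inG)
      with True show ?thesis by (auto simp: R_def endo_algebra_def)
    qed (simp add: \<Gamma>_def \<tau>_def R_def endo_algebra_def)
  qed
  have D_zero: "(g, h) \<notin> D \<longleftrightarrow> \<Gamma> g \<otimes>\<^bsub>R\<^esub> \<Gamma> h = \<zero>\<^bsub>R\<^esub>"
    if gh: "g \<in> carrier G" "h \<in> carrier G" for g h
  proof -
    have "(\<exists>A \<in> \<A>. \<exists>s \<in> A. h \<otimes> s \<in> A \<and> g \<otimes> (h \<otimes> s) \<in> A) \<longleftrightarrow>
       (\<exists>A \<in> \<A>. \<exists>s \<in> A. inv g \<otimes> s \<in> A \<and> inv (g \<otimes> h) \<otimes> s \<in> A)" (is "?L \<longleftrightarrow> ?R")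
    proof
      \<comment> \<open>A product of operators is evaluated at the end point of the path s, hs, ghs,
        whereas \<open>D\<close> is described by its starting point. The two witnesses pass from one
        to the other.\<close>
      assume ?L
      then obtain A s where s: "A \<in> \<A>" "s \<in> A" "h \<otimes> s \<in> A" "g \<otimes> (h \<otimes> s) \<in> A" by blast
      then show ?R using gh
        by (intro bexI[of _ A] bexI[of _ "g \<otimes> (h \<otimes> s)"])
           (simp_all add: G.inv_mult_group G.m_assoc inG cancel)
    next
      assume ?R
      then obtain A s where s: "A \<in> \<A>" "s \<in> A" "inv g \<otimes> s \<in> A" "inv (g \<otimes> h) \<otimes> s \<in> A" by blast
      then show ?L using gh
        by (intro bexI[of _ A] bexI[of _ "inv (g \<otimes> h) \<otimes> s"])
           (simp_all add: G.inv_mult_group G.m_assoc inG cancel)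
    qed
    then show ?thesis using gh by (auto simp: D \<Gamma>_def \<tau>_mult \<tau>_zero)
  qed
  \<comment> \<open>At (A, s) both sides require gs and h^-1 s to lie in A. The additional
    intermediate point on the left is s itself, which is in A. The identity \<open>right\<close>
    below is similar, with g^-1 s occurring twice.\<close>
  have left: "\<Gamma> (inv g) \<otimes>\<^bsub>R\<^esub> \<Gamma> g \<otimes>\<^bsub>R\<^esub> \<Gamma> h = \<Gamma> (inv g) \<otimes>\<^bsub>R\<^esub> \<Gamma> (g \<otimes> h)"
    if gh: "g \<in> carrier G" "h \<in> carrier G" for g h
  proof -
    have "inv g \<otimes> (g \<otimes> h) = h" using gh by (simp add: G.m_assoc[symmetric])
    then show ?thesis using gh by (auto simp: \<Gamma>_def \<tau>_mult inG intro!: \<tau>_cong)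
  qed
  have right: "\<Gamma> g \<otimes>\<^bsub>R\<^esub> \<Gamma> h \<otimes>\<^bsub>R\<^esub> \<Gamma> (inv h) = \<Gamma> (g \<otimes> h) \<otimes>\<^bsub>R\<^esub> \<Gamma> (inv h)"
    if gh: "g \<in> carrier G" "h \<in> carrier G" for g h
    using gh by (auto simp: \<Gamma>_def \<tau>_mult G.m_assoc intro!: \<tau>_cong)
  have \<Gamma>_mem: "\<Gamma> g \<in> carrier R" for g by (simp add: \<Gamma>_def \<tau>_mem)
  have "partial_projective_rep K G R \<Gamma> (support_indicator K G D)"
    unfolding partial_projective_rep_def
  proof (intro conjI ballI)
    fix g h assume gh: "g \<in> carrier G" "h \<in> carrier G"
    let ?\<sigma> = "support_indicator K G D (g, h)"
    have 0: "\<Gamma> g \<otimes>\<^bsub>R\<^esub> \<Gamma> h = \<zero>\<^bsub>R\<^esub> \<longleftrightarrow> ?\<sigma> = \<zero>\<^bsub>K\<^esub>"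
      using gh K1 by (auto simp: support_indicator_def D_zero[symmetric])
    then show "\<Gamma> g \<otimes>\<^bsub>R\<^esub> \<Gamma> h = \<zero>\<^bsub>R\<^esub> \<longrightarrow> ?\<sigma> = \<zero>\<^bsub>K\<^esub>" by simp
    have l0: "\<Gamma> (inv g) \<otimes>\<^bsub>R\<^esub> \<Gamma> (g \<otimes> h) = \<zero>\<^bsub>R\<^esub>" if "?\<sigma> = \<zero>\<^bsub>K\<^esub>"
    proof -
      have "\<Gamma> (inv g) \<otimes>\<^bsub>R\<^esub> \<Gamma> g \<otimes>\<^bsub>R\<^esub> \<Gamma> h = \<zero>\<^bsub>R\<^esub>"
        using 0 that by (simp add: m_assoc \<Gamma>_mem)
      then show ?thesis by (simp add: left[OF gh])
    qed
    have r0: "\<Gamma> (g \<otimes> h) \<otimes>\<^bsub>R\<^esub> \<Gamma> (inv h) = \<zero>\<^bsub>R\<^esub>" if "?\<sigma> = \<zero>\<^bsub>K\<^esub>"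
    proof -
      have "\<Gamma> g \<otimes>\<^bsub>R\<^esub> \<Gamma> h \<otimes>\<^bsub>R\<^esub> \<Gamma> (inv h) = \<zero>\<^bsub>R\<^esub>"
        using 0 that by (simp add: \<Gamma>_mem)
      then show ?thesis by (simp add: right[OF gh])
    qed
    show "?\<sigma> = \<zero>\<^bsub>K\<^esub> \<longrightarrow> \<Gamma> (inv g) \<otimes>\<^bsub>R\<^esub> \<Gamma> (g \<otimes> h) = \<zero>\<^bsub>R\<^esub> \<and> \<Gamma> (g \<otimes> h) \<otimes>\<^bsub>R\<^esub> \<Gamma> (inv h) = \<zero>\<^bsub>R\<^esub>"
      using l0 r0 by simp
    \<comment> \<open>By \<open>left\<close> and \<open>right\<close> the required equations hold
      with scalar 1. If the scalar is 0, both of their sides vanish by \<open>l0\<close> and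
      \<open>r0\<close>.\<close>
    have cases: "?\<sigma> = \<one>\<^bsub>K\<^esub> \<or> ?\<sigma> = \<zero>\<^bsub>K\<^esub>" using gh by (simp add: support_indicator_def)
    then show "\<Gamma> (inv g) \<otimes>\<^bsub>R\<^esub> \<Gamma> g \<otimes>\<^bsub>R\<^esub> \<Gamma> h = ?\<sigma> \<odot>\<^bsub>R\<^esub> (\<Gamma> (inv g) \<otimes>\<^bsub>R\<^esub> \<Gamma> (g \<otimes> h))"
      using l0 by (auto simp: left[OF gh] \<Gamma>_mem)
    show "\<Gamma> g \<otimes>\<^bsub>R\<^esub> \<Gamma> h \<otimes>\<^bsub>R\<^esub> \<Gamma> (inv h) = ?\<sigma> \<odot>\<^bsub>R\<^esub> (\<Gamma> (g \<otimes> h) \<otimes>\<^bsub>R\<^esub> \<Gamma> (inv h))"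
      using cases r0 by (auto simp: right[OF gh] \<Gamma>_mem)
  qed (auto simp: \<Gamma>_mem one support_indicator_def)
  \<comment> \<open>The identity operator is nonzero because (A0, s0) is a point of the disjoint
    union.\<close>
  moreover have "\<one>\<^bsub>R\<^esub> \<noteq> \<zero>\<^bsub>R\<^esub>"
    unfolding one[symmetric] \<Gamma>_def \<tau>_zero using ne inG[OF ne] by (auto intro!: bexI[of _ A0] bexI[of _ s0])
  ultimately show ?thesis
    by (intro factor_set_in_pm[OF G]) unfold_locales
qed

text \<open>A pair (x, y) should be read as the path 1, y, xy, up to right translation. The three
  moves then swap its last two vertices, swap its first two vertices, and replace its first vertex
  by the second.\<close>

definition support_closed :: "('g, 'n) monoid_scheme \<Rightarrow> ('g \<times> 'g) set \<Rightarrow> bool" where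
  "support_closed G D \<longleftrightarrow> (\<one>\<^bsub>G\<^esub>, \<one>\<^bsub>G\<^esub>) \<in> D \<and> D \<subseteq> carrier G \<times> carrier G \<and>
     (\<forall>(x, y) \<in> D. {(inv\<^bsub>G\<^esub> x, x \<otimes>\<^bsub>G\<^esub> y), (x \<otimes>\<^bsub>G\<^esub> y, inv\<^bsub>G\<^esub> y), (x, \<one>\<^bsub>G\<^esub>)} \<subseteq> D)"

text \<open>The triangles {1, y, xy} with (x, y) in \<open>D\<close> realise \<open>D\<close>: a
  pair (g, h) of \<open>D\<close> is a path in its own triangle, and conversely the moves allowed by
  \<open>support_closed\<close> produce every path whose vertices lie in a given triangle.\<close>

lemma indicator_idempotent_factor_set:
  fixes K :: "('k, 'm) ring_scheme" and G :: "('g, 'n) monoid_scheme" (structure)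
  assumes K: "cring K" and K1: "\<one>\<^bsub>K\<^esub> \<noteq> \<zero>\<^bsub>K\<^esub>" and G: "group G" and D: "support_closed G D"
  shows "support_indicator K G D \<in> idempotent_factor_sets K G"
proof -
  interpret G: group G by fact
  have sub: "x \<in> carrier G \<and> y \<in> carrier G" if "(x, y) \<in> D" for x y
    using D that by (auto simp: support_closed_def)
  have one: "(\<one>, \<one>) \<in> D" using D by (simp add: support_closed_def)
  have c: "(inv x, x \<otimes> y) \<in> D" "(x \<otimes> y, inv y) \<in> D" "(x, \<one>) \<in> D" if "(x, y) \<in> D" for x y
    using D that by (auto simp: support_closed_def)
  have cancel: "inv x \<otimes> (x \<otimes> y) = y" "x \<otimes> (inv x \<otimes> y) = y"
    if "x \<in> carrier G" "y \<in> carrier G" for x y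
    using that by (simp_all add: G.m_assoc[symmetric])
  define T where "T p = (case p of (x, y) \<Rightarrow> {\<one>, y, x \<otimes> y})" for p
  have tri: "(g, h) \<in> D"
    if xy: "(x, y) \<in> D" and gh: "g \<in> carrier G" "h \<in> carrier G"
      and s: "s \<in> {\<one>, y, x \<otimes> y}" "h \<otimes> s \<in> {\<one>, y, x \<otimes> y}" "g \<otimes> (h \<otimes> s) \<in> {\<one>, y, x \<otimes> y}"
    for x y g h s
  proof -
    have xyG: "x \<in> carrier G" "y \<in> carrier G" using sub xy by auto
    define t where "t = h \<otimes> s"
    define u where "u = g \<otimes> t"
    have sG: "s \<in> carrier G" using s xyG by auto
    have tG: "t \<in> carrier G" unfolding t_def using gh sG by auto
    have ht: "h = t \<otimes> inv s" using gh sG by (simp add: t_def G.m_assoc)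
    have gt: "g = u \<otimes> inv t" using gh tG by (simp add: u_def G.m_assoc)
    have xy1: "(x, y) \<in> D" by fact
    have xy2: "(inv x, x \<otimes> y) \<in> D" using c xy by blast
    have xy3: "(x \<otimes> y, inv y) \<in> D" using c xy by blast
    have xy4: "(inv y \<otimes> inv x, x) \<in> D"
      using c(1)[OF xy3] xyG by (simp add: G.inv_mult_group G.m_assoc)
    have xy5: "(y, inv y \<otimes> inv x) \<in> D"
      using c(2)[OF xy2] xyG by (simp add: G.inv_mult_group cancel)
    have xy6: "(inv y, inv x) \<in> D"
      using c(2)[OF xy4] xyG by (simp add: G.m_assoc)
    note six = xy1 xy2 xy3 xy4 xy5 xy6
    \<comment> \<open>These are the paths with just two distinct vertices: one edge z remains, and
      the pair depends on which two of the three positions coincide.\<close>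
    have pt: "(z, \<one>) \<in> D" "(\<one>, z) \<in> D" "(z, inv z) \<in> D" if "(z, w) \<in> D" for z w
    proof -
      have z: "z \<in> carrier G" using sub that by blast
      show z1: "(z, \<one>) \<in> D" using c that by blast
      have zz: "(inv z, z) \<in> D" using c(1)[OF z1] z by simp
      show zi: "(z, inv z) \<in> D" using c(1)[OF c(3)[OF zz]] z by simp
      show "(\<one>, z) \<in> D" using c(2)[OF zi] z by simp
    qed
    note deg = six[THEN pt(1)] six[THEN pt(2)] six[THEN pt(3)]
    \<comment> \<open>There are 27 choices of the vertices s, t, u. The 6 permutations of the
      triangle are covered by \<open>six\<close>, the 18 paths on two vertices by \<open>deg\<close>
      (the first entries in \<open>six\<close> are all six oriented edges), and the 3 constant paths
      by \<open>one\<close>.\<close>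
    have "(u \<otimes> inv t, t \<otimes> inv s) \<in> D"
      using s[folded t_def, folded u_def] xyG six deg one
      by (elim insertE emptyE) (simp_all add: G.inv_mult_group G.m_assoc cancel)
    then show ?thesis by (simp add: ht[symmetric] gt[symmetric])
  qed
  have in_D: "(g, h) \<in> D \<longleftrightarrow> (\<exists>A \<in> T ` D. \<exists>s \<in> A. h \<otimes> s \<in> A \<and> g \<otimes> (h \<otimes> s) \<in> A)"
    if gh: "g \<in> carrier G" "h \<in> carrier G" for g h
  proof
    assume "(g, h) \<in> D"
    then show "\<exists>A \<in> T ` D. \<exists>s \<in> A. h \<otimes> s \<in> A \<and> g \<otimes> (h \<otimes> s) \<in> A"
      using gh by (intro bexI[of _ "T (g, h)"] bexI[of _ \<one>]) (auto simp: T_def)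
  next
    assume "\<exists>A \<in> T ` D. \<exists>s \<in> A. h \<otimes> s \<in> A \<and> g \<otimes> (h \<otimes> s) \<in> A"
    then obtain p s where p: "p \<in> D"
      and ps: "s \<in> T p" "h \<otimes> s \<in> T p" "g \<otimes> (h \<otimes> s) \<in> T p" by blast
    obtain x y where "p = (x, y)" by (cases p)
    with p ps have xy: "(x, y) \<in> D"
      and s: "s \<in> T (x, y)" "h \<otimes> s \<in> T (x, y)" "g \<otimes> (h \<otimes> s) \<in> T (x, y)" by simp_all
    show "(g, h) \<in> D"
      by (rule tri[OF xy gh]) (use s in \<open>simp_all only: T_def prod.case\<close>)
  qed
  have "support_indicator K G D \<in> pm K G"
  proof (rule triangle_indicator_in_pm[OF K K1 G])
    show "A \<subseteq> carrier G" if "A \<in> T ` D" for A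
      using that sub by (auto simp: T_def)
    show "T (\<one>, \<one>) \<in> T ` D" using one by blast
    show "\<one> \<in> T (\<one>, \<one>)" by (simp add: T_def)
  qed (rule in_D)
  then show ?thesis by (auto simp: idempotent_factor_sets_def support_indicator_def)
qed

text \<open>Applying condition (i) to a moved pair makes \<Gamma> g times \<Gamma> h vanish, since
  the move undoes itself, and then (ii) gives \<sigma> (g, h) = 0. Thus each closure property is
  proved in contrapositive form.\<close>

lemma support_closed_of_pm:
  fixes K :: "('k, 'm) ring_scheme" and G :: "('g, 'n) monoid_scheme" (structure)
  assumes K: "cring K" and G: "group G" and \<sigma>: "\<sigma> \<in> pm K G"
  shows "support_closed G {p \<in> carrier G \<times> carrier G. \<sigma> p \<noteq> \<zero>\<^bsub>K\<^esub>}"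
proof -
  interpret G: group G by fact
  obtain R :: "('k, ('k \<times> 'g list) list) module" and \<Gamma> where
    R: "assoc_algebra K R" "\<one>\<^bsub>R\<^esub> \<noteq> \<zero>\<^bsub>R\<^esub>" and rep: "partial_projective_rep K G R \<Gamma> \<sigma>"
    using \<sigma> by (auto simp: pm_def)
  interpret assoc_algebra K R by fact
  have \<Gamma>: "\<Gamma> g \<in> carrier R" if "g \<in> carrier G" for g
    using rep that by (auto simp: partial_projective_rep_def)
  have \<Gamma>1: "\<Gamma> \<one> = \<one>\<^bsub>R\<^esub>" using rep by (simp add: partial_projective_rep_def)
  have z: "\<Gamma> (inv g) \<otimes>\<^bsub>R\<^esub> \<Gamma> (g \<otimes> h) = \<zero>\<^bsub>R\<^esub>" "\<Gamma> (g \<otimes> h) \<otimes>\<^bsub>R\<^esub> \<Gamma> (inv h) = \<zero>\<^bsub>R\<^esub>"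
    if "g \<in> carrier G" "h \<in> carrier G" "\<sigma> (g, h) = \<zero>\<^bsub>K\<^esub>" for g h
    using rep that by (simp_all add: partial_projective_rep_def)
  have nz: "\<sigma> (g, h) = \<zero>\<^bsub>K\<^esub>" if "g \<in> carrier G" "h \<in> carrier G" "\<Gamma> g \<otimes>\<^bsub>R\<^esub> \<Gamma> h = \<zero>\<^bsub>R\<^esub>" for g h
    using rep that by (simp add: partial_projective_rep_def)
  have cancel: "inv x \<otimes> (x \<otimes> y) = y" if "x \<in> carrier G" "y \<in> carrier G" for x y
    using that by (simp add: G.m_assoc[symmetric])
  have c1: "\<sigma> (g, h) = \<zero>\<^bsub>K\<^esub>"
    if gh: "g \<in> carrier G" "h \<in> carrier G" "\<sigma> (inv g, g \<otimes> h) = \<zero>\<^bsub>K\<^esub>" for g h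
    using z(1)[OF _ _ gh(3)] gh(1,2) by (simp add: cancel nz)
  have c2: "\<sigma> (g, h) = \<zero>\<^bsub>K\<^esub>"
    if gh: "g \<in> carrier G" "h \<in> carrier G" "\<sigma> (g \<otimes> h, inv h) = \<zero>\<^bsub>K\<^esub>" for g h
    using z(2)[OF _ _ gh(3)] gh(1,2) by (simp add: G.m_assoc nz)
  \<comment> \<open>This is the converse of (ii). Condition (i) yields a vanishing product for the
    moved pair, (ii) makes \<sigma> vanish there, and (i) applied once more moves back to (g,
    h).\<close>
  have zero: "\<Gamma> g \<otimes>\<^bsub>R\<^esub> \<Gamma> h = \<zero>\<^bsub>R\<^esub>"
    if gh: "g \<in> carrier G" "h \<in> carrier G" "\<sigma> (g, h) = \<zero>\<^bsub>K\<^esub>" for g h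
  proof -
    have "\<sigma> (inv g, g \<otimes> h) = \<zero>\<^bsub>K\<^esub>" using z(1)[OF gh] gh nz by simp
    then have "\<Gamma> (inv (inv g)) \<otimes>\<^bsub>R\<^esub> \<Gamma> (inv g \<otimes> (g \<otimes> h)) = \<zero>\<^bsub>R\<^esub>" using gh by (intro z) auto
    then show ?thesis using gh by (simp add: cancel)
  qed
  \<comment> \<open>Since \<Gamma> \<one> is the unit, vanishing of \<sigma> at (g, \<one>) forces
    \<Gamma> g itself to be 0.\<close>
  have c3: "\<sigma> (g, h) = \<zero>\<^bsub>K\<^esub>"
    if gh: "g \<in> carrier G" "h \<in> carrier G" "\<sigma> (g, \<one>) = \<zero>\<^bsub>K\<^esub>" for g h
    using zero[OF gh(1) _ gh(3)] gh \<Gamma> by (intro nz) (simp_all add: \<Gamma>1)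
  have one: "\<sigma> (\<one>, \<one>) \<noteq> \<zero>\<^bsub>K\<^esub>" using zero[of \<one> \<one>] R(2) by (auto simp: \<Gamma>1)
  let ?D = "{p \<in> carrier G \<times> carrier G. \<sigma> p \<noteq> \<zero>\<^bsub>K\<^esub>}"
  have "{(inv x, x \<otimes> y), (x \<otimes> y, inv y), (x, \<one>)} \<subseteq> ?D" if "(x, y) \<in> ?D" for x y
    using that c1[of x y] c2[of x y] c3[of x y] by auto
  then show ?thesis
    unfolding support_closed_def using one by blast
qed

section \<open>The infinite dihedral group\<close>

lemma Rot_in_S_set: "Rot i \<in> S_set \<nu> \<longleftrightarrow> i \<noteq> 0 \<and> fst \<nu> \<bar>i\<bar> = 0"
  and Ref_in_S_set: "Ref i \<in> S_set \<nu> \<longleftrightarrow> snd \<nu> i = 0"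
proof -
  show "Rot i \<in> S_set \<nu> \<longleftrightarrow> i \<noteq> 0 \<and> fst \<nu> \<bar>i\<bar> = 0"
  proof (cases "i > 0")
    case False
    then have "Rot i \<in> S_set \<nu> \<longleftrightarrow> (\<exists>k > 0. fst \<nu> k = 0 \<and> i = - k)"
      by (auto simp: S_set_def b_a_pow) (auto simp: a_pow)
    also have "\<dots> \<longleftrightarrow> i \<noteq> 0 \<and> fst \<nu> \<bar>i\<bar> = 0"
      using False by (auto intro!: exI[of _ "- i"])
    finally show ?thesis .
  qed (auto simp: S_set_def b_a_pow, auto simp: a_pow)
  show "Ref i \<in> S_set \<nu> \<longleftrightarrow> snd \<nu> i = 0"
    by (auto simp: S_set_def b_a_pow) (auto simp: a_pow)
qed

lemma in_W_set:
  "(Rot n, Rot m) \<in> W_set \<omega> \<longleftrightarrow> n > 0 \<and> m > 0 \<and> fst \<omega> (n, m) = 0"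
  "(Rot n, Ref j) \<in> W_set \<omega> \<longleftrightarrow> n > 0 \<and> snd \<omega> (n, j) = 0"
  "(Ref j, x) \<notin> W_set \<omega>"
  by (auto simp: W_set_def b_a_pow) (auto simp: a_pow)

text \<open>Either move merely permutes the six pairs listed in \<open>C_set\<close>.\<close>

lemma C_set_eq:
  "C_set x y = C_set (inv\<^bsub>Dinf\<^esub> x) (x \<otimes>\<^bsub>Dinf\<^esub> y)"
  "C_set x y = C_set (x \<otimes>\<^bsub>Dinf\<^esub> y) (inv\<^bsub>Dinf\<^esub> y)"
  by (cases x; cases y; auto simp: C_set_def mult_Dinf inv_Dinf)+

section \<open>Supports defined by the parameters\<close>

definition nu_omega_support :: "nu \<Rightarrow> omega \<Rightarrow> (dinf \<times> dinf) set" where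
  "nu_omega_support \<nu> \<omega> =
     {(x, y). {x, y, x \<otimes>\<^bsub>Dinf\<^esub> y} \<inter> S_set \<nu> = {} \<and> C_set x y \<inter> W_set \<omega> = {}}"

lemma sigma_nu_omega_eq_indicator:
  assumes "cring K"
  shows "(\<lambda>xy. sigma_nu K \<nu> xy \<otimes>\<^bsub>K\<^esub> sigma_omega K \<omega> xy) =
    support_indicator K Dinf (nu_omega_support \<nu> \<omega>)"
proof -
  interpret cring K by fact
  show ?thesis
    by (rule ext)
       (simp add: sigma_nu_def sigma_omega_def support_indicator_def nu_omega_support_def
          split: prod.split)
qed

text \<open>Up to inverses, to which \<open>S_set\<close> is insensitive, the moves permute x, y and
  xy; they also preserve \<open>C_set\<close>. For the pair (x, 1) the conditions reduce to that on
  x.\<close>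

lemma support_closed_nu_omega: "support_closed Dinf (nu_omega_support \<nu> \<omega>)"
proof -
  have S_inv: "inv\<^bsub>Dinf\<^esub> x \<in> S_set \<nu> \<longleftrightarrow> x \<in> S_set \<nu>" for x
    by (cases x) (auto simp: Rot_in_S_set Ref_in_S_set inv_Dinf)
  \<comment> \<open>In each pair of the orbit of (x, 1) one of the two entries or their product is
    1, which happens for no pair in \<open>W_set\<close> because its exponents \<open>n\<close> and
    \<open>m\<close> are positive.\<close>
  have C_one: "C_set x (Rot 0) \<inter> W_set \<omega> = {}" for x
    by (cases x) (auto simp: C_set_def mult_Dinf inv_Dinf in_W_set)
  have cancel: "inv\<^bsub>Dinf\<^esub> x \<otimes>\<^bsub>Dinf\<^esub> (x \<otimes>\<^bsub>Dinf\<^esub> y) = y"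
    "x \<otimes>\<^bsub>Dinf\<^esub> y \<otimes>\<^bsub>Dinf\<^esub> inv\<^bsub>Dinf\<^esub> y = x" for x y
    by (cases x; cases y; simp add: mult_Dinf inv_Dinf)+
  have right_one: "x \<otimes>\<^bsub>Dinf\<^esub> Rot 0 = x" for x
    using Dinf.r_one[of x] by (simp add: one_Dinf)
  show ?thesis
    unfolding support_closed_def nu_omega_support_def
    by (auto simp: S_inv C_one cancel right_one one_Dinf Rot_in_S_set C_set_eq[symmetric])
qed

section \<open>Normal forms of orbits and recovery of a support from its parameters\<close>

lemma C_set_normal_form:
  assumes "x \<noteq> Rot 0" "y \<noteq> Rot 0" "x \<otimes>\<^bsub>Dinf\<^esub> y \<noteq> Rot 0"
  obtains n m where "n > 0" "m > 0" "(Rot n, Rot m) \<in> C_set x y"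
    | n j where "n > 0" "(Rot n, Ref j) \<in> C_set x y"
proof (cases x; cases y)
  fix i j assume xy: "x = Rot i" "y = Rot j"
  then have "i \<noteq> 0" "j \<noteq> 0" "i + j \<noteq> 0" using assms by (auto simp: mult_Dinf)
  then consider "i > 0 \<and> j > 0" | "i < 0 \<and> j < 0" | "i > 0 \<and> j < 0 \<and> i + j > 0"
    | "i > 0 \<and> j < 0 \<and> i + j < 0" | "i < 0 \<and> j > 0 \<and> i + j > 0" | "i < 0 \<and> j > 0 \<and> i + j < 0"
    by linarith
  \<comment> \<open>The vertices of the triangle are rotations with the distinct exponents 0, j and
    i + j. Running through them in increasing order gives two positive steps; the six cases are the
    six possible orders.\<close>
  then show thesis
  proof cases
    case 1 then show thesis by (intro that(1)[of i j]) (auto simp: xy C_set_def)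
  next
    case 2 then show thesis
      by (intro that(1)[of "- j" "- i"]) (auto simp: xy C_set_def inv_Dinf)
  next
    case 3 then show thesis
      by (intro that(1)[of "i + j" "- j"]) (auto simp: xy C_set_def mult_Dinf inv_Dinf)
  next
    case 4 then show thesis
      by (intro that(1)[of "- j - i" i]) (auto simp: xy C_set_def mult_Dinf inv_Dinf)
  next
    case 5 then show thesis
      by (intro that(1)[of "- i" "i + j"]) (auto simp: xy C_set_def mult_Dinf inv_Dinf)
  next
    case 6 then show thesis
      by (intro that(1)[of j "- j - i"]) (auto simp: xy C_set_def mult_Dinf inv_Dinf)
  qed
next
  fix i j assume xy: "x = Rot i" "y = Ref j"
  then have "i \<noteq> 0" using assms by auto
  then show thesis
    \<comment> \<open>Whenever a reflection occurs, exactly two of the three vertices differ by a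
      rotation. The two candidates are the two orientations of that edge, and the sign of its
      exponent selects one; the remaining cases below follow the same pattern.\<close>
    using that(2)[of i j] that(2)[of "- i" "j - i"]
    by (cases "i > 0") (auto simp: xy C_set_def mult_Dinf inv_Dinf)
next
  fix i j assume xy: "x = Ref i" "y = Rot j"
  then have "j \<noteq> 0" using assms by auto
  then show thesis
    using that(2)[of j "i + j"] that(2)[of "- j" i]
    by (cases "j > 0") (auto simp: xy C_set_def mult_Dinf inv_Dinf)
next
  fix i j assume xy: "x = Ref i" "y = Ref j"
  then have "j - i \<noteq> 0" using assms by (auto simp: mult_Dinf)
  then show thesis
    using that(2)[of "j - i" j] that(2)[of "i - j" i]
    by (cases "j - i > 0") (auto simp: xy C_set_def mult_Dinf inv_Dinf)
qed

text \<open>A closed set is a union of orbits, and each orbit contains some (x, 1) or a normal form.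
  Hence it is determined by the membership of these pairs, which is what the parameters record. This
  provides preimages for surjectivity.\<close>

lemma support_closed_Dinf_eq:
  assumes D: "support_closed Dinf D"
    and nu0: "\<And>i. i > 0 \<Longrightarrow> fst \<nu> i = 0 \<longleftrightarrow> (Rot i, Rot 0) \<notin> D"
    and nu1: "\<And>i. snd \<nu> i = 0 \<longleftrightarrow> (Ref i, Rot 0) \<notin> D"
    and om0: "\<And>n m. n > 0 \<Longrightarrow> m > 0 \<Longrightarrow> fst \<omega> (n, m) = 0 \<longleftrightarrow> (Rot n, Rot m) \<notin> D"
    and om1: "\<And>n j. n > 0 \<Longrightarrow> snd \<omega> (n, j) = 0 \<longleftrightarrow> (Rot n, Ref j) \<notin> D"
  shows "D = nu_omega_support \<nu> \<omega>"
proof -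
  have one: "(Rot 0, Rot 0) \<in> D" using D by (simp add: support_closed_def one_Dinf)
  have cl: "(inv\<^bsub>Dinf\<^esub> x, x \<otimes>\<^bsub>Dinf\<^esub> y) \<in> D" "(x \<otimes>\<^bsub>Dinf\<^esub> y, inv\<^bsub>Dinf\<^esub> y) \<in> D" "(x, Rot 0) \<in> D"
    if "(x, y) \<in> D" for x y
    using D that by (auto simp: support_closed_def one_Dinf)
  have cancel: "inv\<^bsub>Dinf\<^esub> x \<otimes>\<^bsub>Dinf\<^esub> (x \<otimes>\<^bsub>Dinf\<^esub> y) = y"
    "x \<otimes>\<^bsub>Dinf\<^esub> y \<otimes>\<^bsub>Dinf\<^esub> inv\<^bsub>Dinf\<^esub> y = x" for x y
    by (cases x; cases y; simp add: mult_Dinf inv_Dinf)+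
  have c1: "(inv\<^bsub>Dinf\<^esub> x, x \<otimes>\<^bsub>Dinf\<^esub> y) \<in> D \<longleftrightarrow> (x, y) \<in> D" for x y
    using cl(1)[of "inv\<^bsub>Dinf\<^esub> x" "x \<otimes>\<^bsub>Dinf\<^esub> y"] cl(1)[of x y] by (auto simp: cancel)
  have c2: "(x \<otimes>\<^bsub>Dinf\<^esub> y, inv\<^bsub>Dinf\<^esub> y) \<in> D \<longleftrightarrow> (x, y) \<in> D" for x y
    using cl(2)[of "x \<otimes>\<^bsub>Dinf\<^esub> y" "inv\<^bsub>Dinf\<^esub> y"] cl(2)[of x y] by (auto simp: cancel)
  have orbit: "p \<in> D \<longleftrightarrow> (x, y) \<in> D" if "p \<in> C_set x y" for p x y
  proof -
    have 3: "(inv\<^bsub>Dinf\<^esub> y \<otimes>\<^bsub>Dinf\<^esub> inv\<^bsub>Dinf\<^esub> x, x) \<in> D \<longleftrightarrow> (x, y) \<in> D"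
      using c1[of "x \<otimes>\<^bsub>Dinf\<^esub> y" "inv\<^bsub>Dinf\<^esub> y"] c2[of x y] by (simp add: cancel Dinf.inv_mult_group)
    have 4: "(y, inv\<^bsub>Dinf\<^esub> y \<otimes>\<^bsub>Dinf\<^esub> inv\<^bsub>Dinf\<^esub> x) \<in> D \<longleftrightarrow> (x, y) \<in> D"
      using c2[of "inv\<^bsub>Dinf\<^esub> x" "x \<otimes>\<^bsub>Dinf\<^esub> y"] c1[of x y] by (simp add: cancel Dinf.inv_mult_group)
    have 5: "(inv\<^bsub>Dinf\<^esub> y, inv\<^bsub>Dinf\<^esub> x) \<in> D \<longleftrightarrow> (x, y) \<in> D"
      using c1[of y "inv\<^bsub>Dinf\<^esub> y \<otimes>\<^bsub>Dinf\<^esub> inv\<^bsub>Dinf\<^esub> x"] 4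
        cancel(1)[of "inv\<^bsub>Dinf\<^esub> y" "inv\<^bsub>Dinf\<^esub> x"] by simp
    show ?thesis using that c1 c2 3 4 5 by (auto simp: C_set_def)
  qed
  have P_inv: "(inv\<^bsub>Dinf\<^esub> x, Rot 0) \<in> D \<longleftrightarrow> (x, Rot 0) \<in> D" for x
    using cl(3)[OF cl(1), of x "Rot 0"] cl(3)[OF cl(1), of "inv\<^bsub>Dinf\<^esub> x" "Rot 0"] by auto
  have S: "x \<in> S_set \<nu> \<longleftrightarrow> (x, Rot 0) \<notin> D" for x
  proof (cases x)
    case (Rot i)
    then show ?thesis
      \<comment> \<open>The parameter is read at positive exponents; negative ones follow by
        inversion, and exponent 0 from the presence of (1, 1) in \<open>D\<close>.\<close>
      using nu0[of i] nu0[of "- i"] P_inv[of x] one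
      by (cases i "0 :: int" rule: linorder_cases) (auto simp: Rot_in_S_set inv_Dinf)
  next
    case (Ref i)
    then show ?thesis by (simp add: Ref_in_S_set nu1)
  qed
  have W: "p \<notin> W_set \<omega>" if "p \<in> D" for p
  proof (cases p)
    case (Pair u w)
    with that show ?thesis
      by (cases u; cases w) (auto simp: in_W_set om0 om1 simp del: neq0_conv)
  qed
  have "(x, y) \<in> nu_omega_support \<nu> \<omega>" if xy: "(x, y) \<in> D" for x y
  proof -
    have "(x, Rot 0) \<in> D" "(x \<otimes>\<^bsub>Dinf\<^esub> y, Rot 0) \<in> D" by (rule cl(3)[OF xy], rule cl(3)[OF cl(2)[OF xy]])
    moreover have "(inv\<^bsub>Dinf\<^esub> y, Rot 0) \<in> D"
      using orbit[of "(inv\<^bsub>Dinf\<^esub> y, inv\<^bsub>Dinf\<^esub> x)" x y] xy by (intro cl(3)) (auto simp: C_set_def)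
    ultimately show ?thesis
      using W orbit[of _ x y] xy by (auto simp: nu_omega_support_def S P_inv)
  qed
  moreover have "(x, y) \<in> D" if xy: "(x, y) \<in> nu_omega_support \<nu> \<omega>" for x y
  proof -
    have CW: "p \<notin> W_set \<omega>" if "p \<in> C_set x y" for p
      using xy that by (auto simp: nu_omega_support_def)
    have P: "(x, Rot 0) \<in> D" "(y, Rot 0) \<in> D"
      using xy by (auto simp: nu_omega_support_def S)
    show ?thesis
    proof (cases "x = Rot 0 \<or> y = Rot 0 \<or> x \<otimes>\<^bsub>Dinf\<^esub> y = Rot 0")
      case True
      \<comment> \<open>A degenerate pair is (x, 1), (1, y) or (x, x^-1). The last two lie in the
        orbits of (y^-1, 1) and (x^-1, 1), so membership is decided by \<nu> alone.\<close>
      have "(Rot 0, y) \<in> C_set (inv\<^bsub>Dinf\<^esub> y) (Rot 0)" "(x, inv\<^bsub>Dinf\<^esub> x) \<in> C_set (inv\<^bsub>Dinf\<^esub> x) (Rot 0)"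
        by (cases y; simp add: C_set_def inv_Dinf mult_Dinf)
           (cases x; simp add: C_set_def inv_Dinf mult_Dinf)
      then have "(Rot 0, y) \<in> D" "(x, inv\<^bsub>Dinf\<^esub> x) \<in> D"
        by (simp_all only: orbit P P_inv)
      moreover have "y = inv\<^bsub>Dinf\<^esub> x" if "x \<otimes>\<^bsub>Dinf\<^esub> y = Rot 0"
        using that by (cases x; cases y) (auto simp: inv_Dinf mult_Dinf)
      ultimately show ?thesis using True P by auto
    next
      case False
      then have "x \<noteq> Rot 0" "y \<noteq> Rot 0" "x \<otimes>\<^bsub>Dinf\<^esub> y \<noteq> Rot 0" by auto
      then show ?thesis
      proof (rule C_set_normal_form)
        fix n m :: int assume nm: "n > 0" "m > 0" "(Rot n, Rot m) \<in> C_set x y"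
        then have "(Rot n, Rot m) \<in> D" using CW[of "(Rot n, Rot m)"] om0 by (simp add: in_W_set)
        with nm orbit show ?thesis by blast
      next
        fix n j :: int assume nj: "n > 0" "(Rot n, Ref j) \<in> C_set x y"
        then have "(Rot n, Ref j) \<in> D" using CW[of "(Rot n, Ref j)"] om1 by (simp add: in_W_set)
        with nj orbit show ?thesis by blast
      qed
    qed
  qed
  ultimately show ?thesis by auto
qed

theorem proposition10p10:
  fixes K :: "('k, 'm) ring_scheme"
  assumes "field K"
  shows "(\<lambda>(\<nu>, \<omega>). \<lambda>xy. sigma_nu K \<nu> xy \<otimes>\<^bsub>K\<^esub> sigma_omega K \<omega> xy)
    \<in> epi (nu_semigroup \<times>\<times> omega_semigroup) (idempotent_factor_semigroup K Dinf)"
proof -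
  interpret field K by fact
  let ?P = "nu_semigroup \<times>\<times> omega_semigroup" and ?F = "idempotent_factor_semigroup K Dinf"
  let ?f = "\<lambda>(\<nu>, \<omega>). \<lambda>xy. sigma_nu K \<nu> xy \<otimes>\<^bsub>K\<^esub> sigma_omega K \<omega> xy"
  have f: "?f (\<nu>, \<omega>) = support_indicator K Dinf (nu_omega_support \<nu> \<omega>)" for \<nu> \<omega>
    using sigma_nu_omega_eq_indicator[OF is_cring] by simp
  have closed: "?f p \<in> carrier ?F" for p
  proof -
    obtain \<nu> \<omega> where p: "p = (\<nu>, \<omega>)" by (metis surj_pair)
    show ?thesis
      using indicator_idempotent_factor_set[OF is_cring one_not_zero group_Dinf support_closed_nu_omega]
      unfolding p f by (simp add: idempotent_factor_semigroup_def)
  qed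
  have mult: "?f (p \<otimes>\<^bsub>?P\<^esub> q) = ?f p \<otimes>\<^bsub>?F\<^esub> ?f q" for p q
  proof -
    obtain \<nu> \<omega> \<nu>' \<omega>' where pq: "p = (\<nu>, \<omega>)" "q = (\<nu>', \<omega>')" by (cases p; cases q) auto
    let ?\<nu> = "\<nu> \<otimes>\<^bsub>nu_semigroup\<^esub> \<nu>'" and ?\<omega> = "\<omega> \<otimes>\<^bsub>omega_semigroup\<^esub> \<omega>'"
    \<comment> \<open>A product of natural numbers vanishes iff a factor does, so multiplying
      parameters unites their zero sets. Supports therefore intersect, as they do when indicators
      are multiplied.\<close>
    have S: "S_set ?\<nu> = S_set \<nu> \<union> S_set \<nu>'"
    proof (rule Set.set_eqI)
      show "x \<in> S_set ?\<nu> \<longleftrightarrow> x \<in> S_set \<nu> \<union> S_set \<nu>'" for x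
        by (cases x; cases \<nu>; cases \<nu>')
           (auto simp: Rot_in_S_set Ref_in_S_set nu_semigroup_def zero_one_def)
    qed
    have W: "W_set ?\<omega> = W_set \<omega> \<union> W_set \<omega>'"
    proof (rule Set.set_eqI)
      show "x \<in> W_set ?\<omega> \<longleftrightarrow> x \<in> W_set \<omega> \<union> W_set \<omega>'" for x
        by (cases x; cases "fst x"; cases "snd x"; cases \<omega>; cases \<omega>')
           (auto simp: in_W_set omega_semigroup_def zero_one_def)
    qed
    have "nu_omega_support ?\<nu> ?\<omega> = nu_omega_support \<nu> \<omega> \<inter> nu_omega_support \<nu>' \<omega>'"
      unfolding nu_omega_support_def S W by blast
    then show ?thesis
      unfolding pq mult_DirProd f
      by (auto simp: idempotent_factor_semigroup_def support_indicator_def intro!: ext)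
  qed
  have "\<sigma> \<in> ?f ` carrier ?P" if "\<sigma> \<in> carrier ?F" for \<sigma>
  proof -
    have \<sigma>: "\<sigma> \<in> pm K Dinf" "\<sigma> p \<in> {\<zero>\<^bsub>K\<^esub>, \<one>\<^bsub>K\<^esub>}" for p
      using that by (cases p; auto simp: idempotent_factor_semigroup_def idempotent_factor_sets_def)+
    define D where "D = {p. \<sigma> p \<noteq> \<zero>\<^bsub>K\<^esub>}"
    have D: "support_closed Dinf D"
      using support_closed_of_pm[OF is_cring group_Dinf \<sigma>(1)] by (simp add: D_def)
    \<comment> \<open>Here idempotency enters: with values 0 and 1 only, \<sigma> is determined by
      its support.\<close>
    have \<sigma>_D: "\<sigma> = support_indicator K Dinf D"
      using \<sigma>(2) by (fastforce simp: support_indicator_def D_def)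
    \<comment> \<open>The parameters are the membership bits of the pairs (x, 1) and of the normal
      forms. Restriction to the index sets makes them extensional, as the carriers of the parameter
      semigroups demand.\<close>
    define \<nu> :: nu where "\<nu> = (\<lambda>i \<in> posints. of_bool ((Rot i, Rot 0) \<in> D), \<lambda>i. of_bool ((Ref i, Rot 0) \<in> D))"
    define \<omega> :: omega where "\<omega> =
      (\<lambda>(n, m) \<in> posints \<times> posints. of_bool ((Rot n, Rot m) \<in> D),
       \<lambda>(n, j) \<in> posints \<times> UNIV. of_bool ((Rot n, Ref j) \<in> D))"
    have "D = nu_omega_support \<nu> \<omega>"
      by (rule support_closed_Dinf_eq[OF D]) (auto simp: \<nu>_def \<omega>_def)
    then have "\<sigma> = ?f (\<nu>, \<omega>)" by (simp only: f \<sigma>_D)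
    moreover have "(\<nu>, \<omega>) \<in> carrier ?P"
      by (auto simp: nu_semigroup_def omega_semigroup_def zero_one_def \<nu>_def \<omega>_def)
    ultimately show ?thesis by blast
  qed
  then show ?thesis
    using closed mult by (auto simp only: epi_def hom_def)
qed

end
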